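(* Let $q$ be a positive integer, let $S\in\mathbb C(u)$ be a rational function of degree $n\ge1$, and let $f(z)=S(e^{z/q})$. For each fixed $a\in\mathbb P^1$, as $r\to\infty$, $$N(r,a;f)=\frac{n-\epsilon_0(a)-\epsilon_\infty(a)}{\pi q}\,r+O(\log r),\qquad \overline N(r,a;f)=\frac{\nu_a}{\pi q}\,r+O(\log r).$$ Accordingly, the Nevanlinna deficiency and the truncated deficiency, defined respectively by $$\delta(a,f)=1-\limsup_{r\to\infty}\frac{N(r,a;f)}{T(r,f)},\qquad \Theta(a,f)=1-\limsup_{r\to\infty}\frac{\overline N(r,a;f)}{T(r,f)},$$ are given by $$\delta(a,f)=\frac{\epsilon_0(a)+\epsilon_\infty(a)}{n},\qquad \Theta(a,f)=1-\frac{\nu_a}{n}.$$ In particular, the only possible deficient values (values $a$ with $\delta(a,f)>0$) are $S(0)$ and $S(\infty)$, and $$\sum_{a\in\mathbb P^1}\delta(a,f)=\frac{e_0(S)+e_\infty(S)}{n},\qquad \sum_{a\in\mathbb P^1}\Theta(a,f)=2.$$ The sums have finite support. If $S(0)=S(\infty)$, the contributions of $0$ and $\infty$ to $\delta$ occur at the same value.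
   Context: $\mathbb P^1=\mathbb C\cup\{\infty\}$, and $S$ is viewed as a map $\mathbb P^1\to\mathbb P^1$. For $p\in\mathbb P^1$, $e_p(S)$ is the local mapping degree (local multiplicity) of $S$ at $p$. For $p\in\{0,\infty\}$ and $a\in\mathbb P^1$, $\epsilon_p(a)=e_p(S)$ if $S(p)=a$ and $\epsilon_p(a)=0$ if $S(p)\neq a$. Also $\nu_a=\#\{\alpha\in\mathbb C^*: S(\alpha)=a\}$ (without multiplicity). $N(r,a;f)$ is the integrated Nevanlinna counting function of the $a$-points of $f$ in $|z|\le r$, with multiplicity, and $\overline N(r,a;f)$ is its truncated version (each $a$-point counted once); for $a=\infty$ the $a$-points are the poles, and the usual convention at the origin is used: with $n(s)$ the number of points in $|z|\le s$, the integrated function is $\int_0^r\frac{n(s)-n(0)}{s}\,ds+n(0)\log r$. $T(r,f)=m(r,f)+N(r,\infty;f)$ with $m(r,f)=\frac1{2\pi}\int_0^{2\pi}\log^+|f(re^{i\theta})|\,d\theta$ is the Nevanlinna characteristic. *)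

theory Defs
  imports
    "HOL-Complex_Analysis.Complex_Analysis"
    "HOL-Computational_Algebra.Computational_Algebra"
    "HOL-Computational_Algebra.Field_as_Ring"
    "HOL-Library.Landau_Symbols"
begin

section \<open>The Riemann sphere\<close>

datatype csphere = Fin complex | Infty

text \<open>The chart \<open>1/u\<close>, as an involution of the sphere.\<close>

primrec recip :: "csphere \<Rightarrow> csphere" where
  "recip (Fin u) = (if u = 0 then Infty else Fin (inverse u))"
| "recip Infty = Fin 0"

text \<open>
  The affine coordinate.  The value at \<open>Infty\<close> is a dummy: below, the coordinate is only used
  near points of the affine chart, or on a circle up to a set of measure zero.
\<close>

primrec coord :: "csphere \<Rightarrow> complex" where
  "coord (Fin u) = u"
| "coord Infty = 0"

text \<open>
  Local multiplicity at \<open>z\<close> of a nonconstant holomorphic map from a neighbourhood of \<open>z\<close> to the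
  sphere: the order of vanishing at \<open>z\<close> of its expression in a chart centred at its value
  (for the value \<open>Infty\<close> this is the order of the pole).
\<close>

definition local_mult :: "(complex \<Rightarrow> csphere) \<Rightarrow> complex \<Rightarrow> nat" where
  "local_mult F z =
     (case F z of
        Fin a \<Rightarrow> nat (zorder (\<lambda>w. coord (F w) - a) z)
      | Infty \<Rightarrow> nat (zorder (\<lambda>w. coord (recip (F w))) z))"

definition local_degree :: "(csphere \<Rightarrow> csphere) \<Rightarrow> csphere \<Rightarrow> nat" where
  "local_degree G p =
     (case p of
        Fin u \<Rightarrow> local_mult (\<lambda>w. G (Fin w)) u
      | Infty \<Rightarrow> local_mult (\<lambda>w. G (recip (Fin w))) 0)"

section \<open>Rational functions as self-maps of the sphere\<close>

text \<open>
  The field \<open>\<complex>(u)\<close> is the type \<^typ>\<open>complex poly fract\<close>; \<^const>\<open>quot_of_fract\<close> yields the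
  representation in lowest terms with monic denominator.
\<close>

definition rat_num :: "complex poly fract \<Rightarrow> complex poly" where
  "rat_num S = fst (quot_of_fract S)"

definition rat_den :: "complex poly fract \<Rightarrow> complex poly" where
  "rat_den S = snd (quot_of_fract S)"

definition rat_degree :: "complex poly fract \<Rightarrow> nat" where
  "rat_degree S = max (degree (rat_num S)) (degree (rat_den S))"

definition rat_map :: "complex poly fract \<Rightarrow> csphere \<Rightarrow> csphere" where
  "rat_map S p =
     (case p of
        Fin u \<Rightarrow>
          (if poly (rat_den S) u = 0 then Infty
           else Fin (poly (rat_num S) u / poly (rat_den S) u))
      | Infty \<Rightarrow>
          (if degree (rat_num S) > degree (rat_den S) then Infty
           else Fin (coeff (rat_num S) (degree (rat_den S)) / lead_coeff (rat_den S))))"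

definition e_mult :: "complex poly fract \<Rightarrow> csphere \<Rightarrow> nat" where
  "e_mult S p = local_degree (rat_map S) p"

definition eps :: "complex poly fract \<Rightarrow> csphere \<Rightarrow> csphere \<Rightarrow> nat" where
  "eps S p a = (if rat_map S p = a then e_mult S p else 0)"

definition nu :: "complex poly fract \<Rightarrow> csphere \<Rightarrow> nat" where
  "nu S a = card {\<alpha>. \<alpha> \<noteq> 0 \<and> rat_map S (Fin \<alpha>) = a}"

section \<open>Nevanlinna functions of a meromorphic function, seen as a map to the sphere\<close>

text \<open>
  For nonconstant meromorphic \<open>f\<close> the set of \<open>a\<close>-points in a closed disc is finite, so that the
  sum and the cardinality below have their intended meaning.
\<close>

definition apoints :: "(complex \<Rightarrow> csphere) \<Rightarrow> csphere \<Rightarrow> real \<Rightarrow> complex set" where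
  "apoints f a s = {z. norm z \<le> s \<and> f z = a}"

definition count_mult :: "(complex \<Rightarrow> csphere) \<Rightarrow> csphere \<Rightarrow> real \<Rightarrow> nat" where
  "count_mult f a s = (\<Sum>z\<in>apoints f a s. local_mult f z)"

definition count_trunc :: "(complex \<Rightarrow> csphere) \<Rightarrow> csphere \<Rightarrow> real \<Rightarrow> nat" where
  "count_trunc f a s = card (apoints f a s)"

definition integrated :: "(real \<Rightarrow> nat) \<Rightarrow> real \<Rightarrow> real" where
  "integrated n r =
     integral {0..r} (\<lambda>s. (real (n s) - real (n 0)) / s) + real (n 0) * ln r"

definition nev_N :: "real \<Rightarrow> csphere \<Rightarrow> (complex \<Rightarrow> csphere) \<Rightarrow> real" where
  "nev_N r a f = integrated (count_mult f a) r"

definition nev_Nbar :: "real \<Rightarrow> csphere \<Rightarrow> (complex \<Rightarrow> csphere) \<Rightarrow> real" where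
  "nev_Nbar r a f = integrated (count_trunc f a) r"

definition log_plus :: "real \<Rightarrow> real" where
  "log_plus x = max 0 (ln x)"

definition nev_m :: "real \<Rightarrow> (complex \<Rightarrow> csphere) \<Rightarrow> real" where
  "nev_m r f =
     integral {0..2*pi} (\<lambda>\<theta>. log_plus (norm (coord (f (of_real r * cis \<theta>))))) / (2 * pi)"

definition nev_T :: "real \<Rightarrow> (complex \<Rightarrow> csphere) \<Rightarrow> real" where
  "nev_T r f = nev_m r f + nev_N r Infty f"

definition deficiency :: "csphere \<Rightarrow> (complex \<Rightarrow> csphere) \<Rightarrow> ereal" where
  "deficiency a f = 1 - Limsup at_top (\<lambda>r. ereal (nev_N r a f / nev_T r f))"

definition trunc_deficiency :: "csphere \<Rightarrow> (complex \<Rightarrow> csphere) \<Rightarrow> ereal" where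
  "trunc_deficiency a f = 1 - Limsup at_top (\<lambda>r. ereal (nev_Nbar r a f / nev_T r f))"

end

theory Submission
  imports Defs "HOL-Real_Asymp.Real_Asymp"
begin

text \<open>
  Write \<open>S = P / Q\<close> in lowest terms and \<open>w = exp (z / q)\<close>.  For \<open>\<alpha> \<noteq> 0\<close> the solutions of \<open>w = \<alpha>\<close> form an
  arithmetic progression with step \<open>2 \<pi> i q\<close>, so there are \<open>s / (\<pi> q) + O(1)\<close> of them in \<open>|z| \<le> s\<close>; since
  \<open>exp\<close> is unramified, weighting each by the order of \<open>\<alpha>\<close> as a root of \<open>P - a Q\<close> gives \<open>N(r,a;f)\<close>.
  For the characteristic, \<open>log\<^sup>+ |P/Q| = log (max |P| |Q|) - log |Q|\<close>.  By coprimality the first term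
  is \<open>n log\<^sup>+ |w| + O(1)\<close> on the whole plane, hence free of singularities; the mean of the second is
  computed root by root from the mean of \<open>log |w - \<beta>|\<close> over \<open>|z| = r\<close>, and cancels against
  \<open>N(r,\<infinity>;f)\<close>.  The truncated deficiencies add up to \<open>2\<close> by the Riemann-Hurwitz formula, obtained by
  counting the zeros of the Wronskian \<open>P' Q - P Q'\<close>.
\<close>

section \<open>Integrated counting functions\<close>

text \<open>The obstacle is that the singularities of log |w - \<beta>| on |z| = r move with r,
  while the error must stay bounded for every large r, including radii whose circle meets a solution
  of w = \<beta>. Hence the comparison with log |sin|, whose integrals are controlled independently
  of r. The points where conventions interfere (\<open>ln 0 = 0\<close>, coordinate 0 at a pole)
  form finite sets on each circle, which integrals ignore. The constant 1/pi arises twice: as the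
  integral 2 of max 0 (cos t) over a period, divided by 2 pi, and from a spacing 2 pi q of points
  running off in both directions of a line. The error log r comes only from the integrated counting
  functions. Multiplicities are read off from the pencil spanned by P and Q: a value selects a
  member, whose roots give the multiplicities at finite points and whose drop in degree below n
  gives the one at infinity. One Wronskian then records the ramification over all values at once,
  poles included.\<close>

lemma integral_between:
  fixes u L U :: "real \<Rightarrow> real"
  assumes u: "u \<in> borel_measurable borel"
    and L: "L integrable_on {a..b}" and U: "U integrable_on {a..b}"
    and E: "finite E"
    and le: "\<And>x. x \<in> {a..b} - E \<Longrightarrow> L x \<le> u x \<and> u x \<le> U x"
  shows "u integrable_on {a..b}"
    and "integral {a..b} L \<le> integral {a..b} u"
    and "integral {a..b} u \<le> integral {a..b} U"
proof -
  \<comment> \<open>At points of \<open>E\<close> the bounds may fail because \<open>ln 0\<close> is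
    0. Resetting both bounds to \<open>u\<close> there makes them valid everywhere without changing
    their integrals.\<close>
  define L' where "L' = (\<lambda>x. if x \<in> E then u x else L x)"
  define U' where "U' = (\<lambda>x. if x \<in> E then u x else U x)"
  have L': "L' integrable_on {a..b}"
    by (rule integrable_spike_finite[OF E _ L]) (auto simp: L'_def)
  have U': "U' integrable_on {a..b}"
    by (rule integrable_spike_finite[OF E _ U]) (auto simp: U'_def)
  have le': "L' x \<le> u x \<and> u x \<le> U' x" if "x \<in> {a..b}" for x
    using le[of x] that by (auto simp: L'_def U'_def)
  \<comment> \<open>Measurability and domination replace continuity, which the logarithms lack:
    \<open>u - L'\<close> is squeezed between 0 and \<open>U' - L'\<close>.\<close>
  have "(\<lambda>x. u x - L' x) integrable_on {a..b}"
  proof (rule measurable_bounded_by_integrable_imp_integrable_real)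
    have "u \<in> borel_measurable (lebesgue_on {a..b})"
      using u by (simp add: borel_measurable_if_I measurable_completion measurable_restrict_space1)
    thus "(\<lambda>x. u x - L' x) \<in> borel_measurable (lebesgue_on {a..b})"
      using integrable_imp_measurable[OF L'] by (rule borel_measurable_diff)
    show "(\<lambda>x. U' x - L' x) integrable_on {a..b}"
      using U' L' by (rule integrable_diff)
    show "\<bar>u x - L' x\<bar> \<le> U' x - L' x" if "x \<in> {a..b}" for x
      using le'[OF that] by auto
  qed auto
  from integrable_add[OF this L'] show int: "u integrable_on {a..b}" by simp
  have "integral {a..b} L = integral {a..b} L'"
    by (rule integral_spike[of E]) (use E in \<open>auto simp: L'_def negligible_finite\<close>)
  also have "\<dots> \<le> integral {a..b} u"
    using le' by (intro integral_le L' int) auto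
  finally show "integral {a..b} L \<le> integral {a..b} u" .
  have "integral {a..b} u \<le> integral {a..b} U'"
    using le' by (intro integral_le U' int) auto
  also have "\<dots> = integral {a..b} U"
    by (rule integral_spike[of E]) (use E in \<open>auto simp: U'_def negligible_finite\<close>)
  finally show "integral {a..b} u \<le> integral {a..b} U" .
qed

lemma has_integral_inverse_Icc:
  fixes d r :: real
  assumes "0 < d" "d \<le> r"
  shows "((\<lambda>s. C / s) has_integral C * (ln r - ln d)) {d..r}"
proof -
  have "((\<lambda>s. C / s) has_integral C * ln r - C * ln d) {d..r}"
    by (rule fundamental_theorem_of_calculus[OF assms(2)])
       (use assms in \<open>auto intro!: derivative_eq_intros
          simp: has_real_derivative_iff_has_vector_derivative[symmetric]\<close>)
  thus ?thesis by (simp add: right_diff_distrib)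
qed

lemma bigo_lnI:
  assumes "\<forall>\<^sub>F r in at_top. \<bar>F r\<bar> \<le> A + B * ln r"
  shows "F \<in> O[at_top](\<lambda>r::real. ln r)"
proof (rule bigoI[of _ "\<bar>A\<bar> + \<bar>B\<bar>"])
  show "\<forall>\<^sub>F r in at_top. norm (F r) \<le> (\<bar>A\<bar> + \<bar>B\<bar>) * norm (ln r)"
    using assms eventually_ge_at_top[of "exp 1"]
  proof eventually_elim
    case (elim r)
    have r: "r > 0" using elim(2) exp_gt_zero[of 1] by linarith
    have "ln r \<ge> 1" using elim(2) r by (simp add: ln_ge_iff)
    have "A \<le> \<bar>A\<bar> * ln r"
      using mult_left_mono[of 1 "ln r" "\<bar>A\<bar>"] \<open>ln r \<ge> 1\<close> by auto
    moreover have "B * ln r \<le> \<bar>B\<bar> * ln r"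
      using \<open>ln r \<ge> 1\<close> by (intro mult_right_mono) auto
    moreover have "(\<bar>A\<bar> + \<bar>B\<bar>) * norm (ln r) = \<bar>A\<bar> * ln r + \<bar>B\<bar> * ln r"
      using \<open>ln r \<ge> 1\<close> by (simp add: distrib_right)
    ultimately show ?case using elim(1) by (simp only: real_norm_def)
  qed
qed

text \<open>The integrand vanishes on \<open>{0..d}\<close>, so nothing diverges at 0; on
  \<open>{d..r}\<close> it is c + O(1/s), which integrates to c r + O(log r). The term with
  \<open>N 0\<close> is itself O(log r).\<close>

lemma integrated_asymp:
  fixes N :: "real \<Rightarrow> nat" and c C d :: real
  assumes mono: "\<And>s t. 0 \<le> s \<Longrightarrow> s \<le> t \<Longrightarrow> N s \<le> N t"
    and bound: "\<And>s. 0 \<le> s \<Longrightarrow> \<bar>real (N s) - c * s\<bar> \<le> C"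
    and d: "0 < d" and const: "\<And>s. 0 \<le> s \<Longrightarrow> s \<le> d \<Longrightarrow> N s = N 0"
  shows "(\<lambda>r. integrated N r - c * r) \<in> O[at_top](\<lambda>r. ln r)"
proof (rule bigo_lnI)
  define h where "h = (\<lambda>s. (real (N s) - real (N 0)) / s)"
  define K where "K = C + N 0"
  have C: "C \<ge> 0" using bound[of 0] by auto
  have "integrated N r - c * r = integral {d..r} (\<lambda>s. h s - c) - c * d + N 0 * ln r \<and>
        \<bar>integral {d..r} (\<lambda>s. h s - c)\<bar> \<le> K * (ln r - ln d)" if r: "r \<ge> d" for r
  proof -
    have "h integrable_on {0..r}"
    \<comment> \<open>The integrand is only rewritten here. Monotonicity is known for nonnegative
      arguments; \<open>max 0 s\<close> extends it to the whole line, which yields Borel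
      measurability.\<close>
    proof (rule integrable_spike_finite[of "{}"])
      show "(\<lambda>s. (real (N (max 0 s)) - real (N 0)) / s) integrable_on {0..r}"
      proof (rule measurable_bounded_by_integrable_imp_integrable_real)
        have "mono (\<lambda>s. real (N (max 0 s)))"
          by (intro monoI) (auto intro!: mono)
        hence "(\<lambda>s. real (N (max 0 s))) \<in> borel_measurable borel"
          by (rule borel_measurable_mono)
        hence "(\<lambda>s. (real (N (max 0 s)) - real (N 0)) / s) \<in> borel_measurable borel"
          by measurable
        thus "(\<lambda>s. (real (N (max 0 s)) - real (N 0)) / s) \<in> borel_measurable (lebesgue_on {0..r})"
          by (simp add: measurable_completion measurable_restrict_space1)
        show "(\<lambda>_. real (N r) / d) integrable_on {0..r}" by (rule integrable_const_ivl)
        show "\<bar>(real (N (max 0 s)) - real (N 0)) / s\<bar> \<le> real (N r) / d" if s: "s \<in> {0..r}" for s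
        proof (cases "s \<le> d")
          case True
          thus ?thesis using const[of s] s d by (auto simp: max_def)
        next
          case False
          have "N 0 \<le> N s" "N s \<le> N r" using s by (auto intro!: mono)
          hence "\<bar>real (N s) - real (N 0)\<bar> \<le> real (N r)" by linarith
          hence "\<bar>real (N s) - real (N 0)\<bar> / s \<le> real (N r) / d"
            using False d by (intro frac_le) auto
          thus ?thesis using s by (simp add: max_def)
        qed
      qed auto
    qed (auto simp: h_def max_def)
    note hint = this
    have hint': "h integrable_on {d..r}"
      by (rule integrable_on_subinterval[OF hint]) (use d in auto)
    have "integral {0..d} h + integral {d..r} h = integral {0..r} h"
      by (rule Henstock_Kurzweil_Integration.integral_combine) (use d r hint in auto)
    also have "integral {0..d} h = integral {0..d} (\<lambda>_. 0)"
    proof (rule integral_cong)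
      show "h s = 0" if "s \<in> {0..d}" for s
        using const[of s] that by (simp add: h_def)
    qed
    finally have 1: "integral {0..r} h = integral {d..r} h" by simp
    have int2: "(\<lambda>s. h s - c) integrable_on {d..r}"
      by (intro integrable_diff hint' integrable_const_ivl)
    have "integral {d..r} (\<lambda>s. h s - c) = integral {d..r} h - c * (r - d)"
      using r by (subst integral_diff[OF hint' integrable_const_ivl]) (simp add: mult.commute)
    hence "integrated N r - c * r = integral {d..r} (\<lambda>s. h s - c) - c * d + N 0 * ln r"
      using 1 by (simp add: integrated_def h_def algebra_simps)
    moreover have "norm (integral {d..r} (\<lambda>s. h s - c)) \<le> integral {d..r} (\<lambda>s. K / s)"
    proof (rule integral_norm_bound_integral[OF int2])
      show "(\<lambda>s. K / s) integrable_on {d..r}"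
        using has_integral_inverse_Icc[OF d r, of K] by blast
      show "norm (h s - c) \<le> K / s" if "s \<in> {d..r}" for s
      proof -
        have s: "s > 0" using that d by auto
        have "h s - c = (real (N s) - c * s - real (N 0)) / s"
          using s by (simp add: h_def field_simps)
        moreover have "\<bar>real (N s) - c * s - real (N 0)\<bar> \<le> K"
          using bound[of s] s by (simp add: K_def)
        ultimately show ?thesis using s by (simp add: divide_right_mono)
      qed
    qed
    ultimately show ?thesis
      using integral_unique[OF has_integral_inverse_Icc[OF d r, of K]] by simp
  qed
  note * = this
  show "\<forall>\<^sub>F r in at_top. \<bar>integrated N r - c * r\<bar> \<le> (\<bar>K * ln d\<bar> + \<bar>c * d\<bar>) + (K + N 0) * ln r"
    using eventually_ge_at_top[of d] eventually_ge_at_top[of 1]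
  proof eventually_elim
    case (elim r)
    define I where "I = integral {d..r} (\<lambda>s. h s - c)"
    have "real (N 0) * ln r \<ge> 0" using elim by simp
    moreover have "integrated N r - c * r = I - c * d + N 0 * ln r" "\<bar>I\<bar> \<le> K * ln r - K * ln d"
      using *[OF elim(1)] by (simp_all add: I_def right_diff_distrib)
    ultimately show ?case
      by (simp only: distrib_right)
  qed
qed

section \<open>Circular means of logarithms of polynomials in an exponential\<close>

lemma half_le_sin:
  fixes x :: real
  assumes "0 \<le> x" "x \<le> pi / 2"
  shows "x / 2 \<le> sin x"
proof -
  \<comment> \<open>A weak form of Jordan's inequality: sin x = 2 sin (x/2) cos (x/2) >= x cos^2
    (x/2), and cos^2 is at least 1/2 on the interval from 0 to pi/4.\<close>
  have aux: "y * cos y \<le> sin y" if "0 \<le> y" "y \<le> pi" for y :: real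
  proof (cases "y = 0")
    case False
    with that have "\<exists>z. 0 < z \<and> z < y \<and> sin y - sin 0 = (y - 0) * cos z"
      by (intro MVT2) (auto intro!: derivative_eq_intros)
    then obtain z where z: "0 < z" "z < y" "sin y = y * cos z" by auto
    have "cos y \<le> cos z" using z that by (intro cos_monotone_0_pi_le) auto
    thus ?thesis using z that by (simp add: mult_left_mono)
  qed auto
  define y where "y = x / 2"
  have y: "0 \<le> y" "y \<le> pi / 4" using assms by (auto simp: y_def)
  have c: "cos y \<ge> sqrt 2 / 2"
    using cos_monotone_0_pi_le[of y "pi / 4"] y by (simp add: cos_45)
  have "(1/2::real) = (sqrt 2 / 2)^2" by (simp add: power_divide)
  also have "\<dots> \<le> cos y ^ 2" using c by (intro power_mono) auto
  finally have "y * (1/2) \<le> y * cos y ^ 2" using y by (intro mult_left_mono) auto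
  also have "\<dots> = (y * cos y) * cos y" by (simp add: power2_eq_square)
  also have "\<dots> \<le> sin y * cos y"
    using c y aux[of y] order_trans[OF _ c, of 0] by (intro mult_right_mono) auto
  also have "\<dots> = sin (2 * y) / 2" by (simp add: sin_double)
  finally show ?thesis by (simp add: y_def)
qed

text \<open>The primitive x ln x - x extends continuously to 0 with value 0, so the fundamental
  theorem needs the derivative in the interior only.\<close>

lemma ln_integrable_Icc: "(\<lambda>x::real. ln x) integrable_on {0..b}"
proof (cases "b > 0")
  case True
  have "((\<lambda>x::real. ln x) has_integral (b * ln b - b) - (0 * ln 0 - 0)) {0..b}"
  proof (rule fundamental_theorem_of_calculus_interior)
    show "continuous_on {0..b} (\<lambda>x. x * ln x - x)"
      unfolding continuous_on_def
    proof
      fix x assume x: "x \<in> {0..b}"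
      show "((\<lambda>x. x * ln x - x) \<longlongrightarrow> x * ln x - x) (at x within {0..b})"
      proof (cases "x = 0")
        case True
        have "((\<lambda>x::real. x * ln x - x) \<longlongrightarrow> 0) (at_right 0)" by real_asymp
        thus ?thesis using True \<open>b > 0\<close> by (simp add: at_within_Icc_at_right)
      qed (use x in \<open>intro tendsto_intros; simp\<close>)
    qed
    show "((\<lambda>x. x * ln x - x) has_vector_derivative ln x) (at x)" if "x \<in> {0<..<b}" for x
      using that by (auto intro!: derivative_eq_intros
          simp: has_real_derivative_iff_has_vector_derivative[symmetric])
  qed (use True in auto)
  thus ?thesis by blast
next
  case False
  thus ?thesis by (cases "b = 0") (use integrable_on_refl[of ln "0::real"] in auto)
qed

lemma ln_abs_sin_integrable_aux:
  "(\<lambda>t::real. ln \<bar>sin (t / 2)\<bar>) integrable_on {0..pi}"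
proof (rule integral_between(1)[where E = "{0}"])
  show "(\<lambda>t::real. ln \<bar>sin (t / 2)\<bar>) \<in> borel_measurable borel" by measurable
  \<comment> \<open>The 4 combines the halved argument t / 2 with the factor 1/2 of
    \<open>half_le_sin\<close>.\<close>
  show "(\<lambda>t::real. ln t - ln 4) integrable_on {0..pi}"
    by (intro integrable_diff ln_integrable_Icc integrable_const_ivl)
  show "(\<lambda>t::real. 0 :: real) integrable_on {0..pi}" by auto
  show "ln t - ln 4 \<le> ln \<bar>sin (t / 2)\<bar> \<and> ln \<bar>sin (t / 2)\<bar> \<le> 0" if "t \<in> {0..pi} - {0}" for t :: real
  proof -
    have "t / 4 \<le> sin (t / 2)" using half_le_sin[of "t / 2"] that by auto
    moreover have "t > 0" using that by auto
    ultimately have "ln (t / 4) \<le> ln \<bar>sin (t / 2)\<bar>" "sin (t / 2) > 0" by auto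
    thus ?thesis using \<open>t > 0\<close> by (simp add: ln_div)
  qed
qed auto

text \<open>The interval contains every window \<open>{\<phi>..2*pi+\<phi>}\<close> with \<phi> in
  \<open>{-pi..pi}\<close>. Evenness and the period 2 pi of |sin (t / 2)| carry integrability over
  from \<open>{0..pi}\<close>.\<close>

lemma ln_abs_sin_integrable: "(\<lambda>t::real. ln \<bar>sin (t / 2)\<bar>) integrable_on {-pi..3*pi}"
proof -
  let ?g = "\<lambda>t::real. ln \<bar>sin (t / 2)\<bar>"
  have "(\<lambda>t. ?g (- t)) integrable_on {-pi..-0}"
    using ln_abs_sin_integrable_aux
    by (subst Henstock_Kurzweil_Integration.integrable_reflect_real)
  hence "?g integrable_on {-pi..0}" by simp
  hence 1: "?g integrable_on {-pi..pi}"
    using ln_abs_sin_integrable_aux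
    by (intro Henstock_Kurzweil_Integration.integrable_combine[of "-pi" 0 pi]) auto
  then obtain I where "(?g has_integral I) {-pi..pi}" by blast
  from has_integral_shift_real_ivl[OF this, of "-(2*pi)"]
  have "((\<lambda>x. ?g (x - 2 * pi)) has_integral I) {pi..3*pi}" by simp
  also have "(\<lambda>x. ?g (x - 2 * pi)) = ?g"
    by (simp add: diff_divide_distrib sin_diff)
  finally have "?g integrable_on {pi..3*pi}" by (rule has_integral_integrable)
  thus ?thesis using 1
    by (intro Henstock_Kurzweil_Integration.integrable_combine[of "-pi" pi "3*pi"]) auto
qed

text \<open>Since log |sin| <= 0, the integral over a shifted window is at least the one over the
  fixed larger interval; this makes \<open>K\<close> uniform in \<phi>.\<close>

lemma ln_abs_sin_shift:
  "\<exists>K. \<forall>\<phi>\<in>{-pi..pi}. (\<lambda>t::real. ln \<bar>sin ((t + \<phi>) / 2)\<bar>) integrable_on {0..2*pi} \<and>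
      - K \<le> integral {0..2*pi} (\<lambda>t. ln \<bar>sin ((t + \<phi>) / 2)\<bar>)"
proof (intro exI ballI)
  let ?g = "\<lambda>t::real. ln \<bar>sin (t / 2)\<bar>"
  fix \<phi> :: real assume \<phi>: "\<phi> \<in> {-pi..pi}"
  have sub: "{\<phi>..2*pi+\<phi>} \<subseteq> {-pi..3*pi}" using \<phi> by auto
  have int: "?g integrable_on {\<phi>..2*pi+\<phi>}"
    by (rule integrable_on_subinterval[OF ln_abs_sin_integrable sub])
  have eq: "((\<lambda>t. ?g (t + \<phi>)) has_integral integral {\<phi>..2*pi+\<phi>} ?g) {0..2*pi}"
    using has_integral_shift_real_ivl[OF integrable_integral[OF int], of \<phi>] by simp
  have le0: "?g t \<le> 0" for t
    by (cases "sin (t / 2) = 0") auto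
  have "integral {\<phi>..2*pi+\<phi>} (\<lambda>t. - ?g t) \<le> integral {-pi..3*pi} (\<lambda>t. - ?g t)"
    using sub int ln_abs_sin_integrable le0
    by (intro integral_subset_le integrable_neg) auto
  hence "- integral {-pi..3*pi} (\<lambda>t. - ?g t) \<le> integral {\<phi>..2*pi+\<phi>} ?g"
    by simp
  with eq show "(\<lambda>t::real. ln \<bar>sin ((t + \<phi>) / 2)\<bar>) integrable_on {0..2*pi} \<and>
      - integral {-pi..3*pi} (\<lambda>t. - ?g t) \<le> integral {0..2*pi} (\<lambda>t. ln \<bar>sin ((t + \<phi>) / 2)\<bar>)"
    by (auto simp: integral_unique)
qed

text \<open>As |exp (\<rho> cis t)| = exp (\<rho> cos t), a prescribed modulus is met, for \<rho> >
  0, only where cos t has one prescribed value. This supplies the finite exceptional sets.\<close>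

lemma finite_cos_eq: "finite {t \<in> {0..2*pi}. cos t = c}"
proof (rule finite_subset)
  show "{t \<in> {0..2*pi}. cos t = c} \<subseteq> {arccos c, 2 * pi - arccos c}"
  proof
    fix t assume "t \<in> {t \<in> {0..2*pi}. cos t = c}"
    hence t: "0 \<le> t" "t \<le> 2 * pi" "cos t = c" by auto
    show "t \<in> {arccos c, 2 * pi - arccos c}"
    proof (cases "t \<le> pi")
      case True
      thus ?thesis using t arccos_cos[of t] by auto
    next
      case False
      thus ?thesis using t arccos_cos[of "2 * pi - t"] by (auto simp: cos_diff)
    qed
  qed
qed auto

text \<open>Source of the constant 1/pi in the characteristic: with |w| = exp (\<rho> cos t) and
  \<rho> >= 0, the circular mean of log^+ |w| is 2 \<rho> / (2 pi).\<close>

lemma integral_max_cos: "((\<lambda>t. max 0 (cos t)) has_integral 2) {0..2*pi}"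
proof -
  have F: "(cos has_integral sin b - sin a) {a..b}" if "a \<le> b" for a b :: real
    by (rule fundamental_theorem_of_calculus[OF that])
       (auto intro!: derivative_eq_intros simp: has_real_derivative_iff_has_vector_derivative[symmetric])
  have 1: "((\<lambda>t. max 0 (cos t)) has_integral 1) {0..pi/2}"
  proof (rule has_integral_eq[of _ cos])
    show "cos t = max 0 (cos t)" if "t \<in> {0..pi/2}" for t
      using cos_ge_zero[of t] that by (auto simp: max_def)
    show "(cos has_integral 1) {0..pi/2}"
      using F[of 0 "pi/2"] by simp
  qed
  have 2: "((\<lambda>t. max 0 (cos t)) has_integral 0) {pi/2..3*pi/2}"
  proof (rule has_integral_eq[of _ "\<lambda>_. 0"])
    show "0 = max 0 (cos t)" if "t \<in> {pi/2..3*pi/2}" for t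
      using cos_ge_zero[of "t - pi"] that by (auto simp: cos_diff max_def)
  qed auto
  have 3: "((\<lambda>t. max 0 (cos t)) has_integral 1) {3*pi/2..2*pi}"
  proof (rule has_integral_eq[of _ cos])
    show "cos t = max 0 (cos t)" if "t \<in> {3*pi/2..2*pi}" for t
      using cos_ge_zero[of "t - 2 * pi"] that by (auto simp: cos_diff max_def)
    show "(cos has_integral 1) {3*pi/2..2*pi}"
      using F[of "3*pi/2" "2*pi"] sin_3over2_pi by simp
  qed
  have "((\<lambda>t. max 0 (cos t)) has_integral (1 + 0) + 1) {0..2*pi}"
    by (rule has_integral_combine[OF _ _ has_integral_combine[OF _ _ 1 2] 3]) auto
  thus ?thesis by simp
qed

section \<open>Means of log |w - \<beta>| and of log |p(w)| for w = exp (\<rho> cis t)\<close>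

lemma norm_exp_cis: "norm (exp (of_real \<rho> * cis t)) = exp (\<rho> * cos t)"
  by (simp add: cis.sel)

lemma log_norm_exp_integral:
  "((\<lambda>t. ln (norm (exp (of_real \<rho> * cis t)))) has_integral 0) {0..2*pi}"
proof -
  have "((\<lambda>t. \<rho> * cos t) has_integral \<rho> * sin (2 * pi) - \<rho> * sin 0) {0..2*pi}"
    by (rule fundamental_theorem_of_calculus)
       (auto intro!: derivative_eq_intros simp: has_real_derivative_iff_has_vector_derivative[symmetric])
  thus ?thesis by (simp add: norm_exp_cis)
qed

text \<open>For v <= u, exp u - exp v = exp u (1 - exp (v - u)), and exp d >= 1 + d with d = u - v
  bounds the bracket. The factor exp (max x b) carries the growth, the quotient only the gap between
  x and b.\<close>

lemma abs_exp_diff_ge: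
  fixes x b :: real
  shows "exp (max x b) * (\<bar>x - b\<bar> / (1 + \<bar>x - b\<bar>)) \<le> \<bar>exp x - exp b\<bar>"
proof -
  have aux: "exp u * ((u - v) / (1 + (u - v))) \<le> exp u - exp v" if "v \<le> u" for u v :: real
  proof -
    have "exp v * (1 + (u - v)) \<le> exp v * exp (u - v)"
      by (intro mult_left_mono) (use exp_ge_add_one_self[of "u - v"] in auto)
    hence "exp v * (1 + (u - v)) \<le> exp u" by (simp add: exp_add[symmetric])
    thus ?thesis using that by (simp add: field_simps)
  qed
  show ?thesis using aux[of b x] aux[of x b] by (cases "b \<le> x") (auto simp: max_def)
qed

text \<open>
  The lower bound only uses \<open>|w - \<beta>| \<ge> ||w| - |\<beta>||\<close> and writes \<open>cos t - cos \<phi>\<close> as a product of sines.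
  This leaves singularities \<open>log |sin ((t \<plusminus> \<phi>) / 2)|\<close> whose integral over a period is finite and
  independent of \<open>\<phi>\<close>, hence of \<open>\<rho>\<close>.
\<close>

lemma log_dist_exp_bounds:
  fixes \<beta> :: complex and \<rho> t :: real
  assumes "\<beta> \<noteq> 0" and \<rho>: "\<rho> \<ge> 1" "\<bar>ln (norm \<beta>)\<bar> \<le> \<rho>"
  defines "\<phi> \<equiv> arccos (ln (norm \<beta>) / \<rho>)"
  shows "ln (norm (exp (of_real \<rho> * cis t) - \<beta>)) \<le> \<rho> * max 0 (cos t) + ln (1 + norm \<beta>)"
    and "cos t \<noteq> ln (norm \<beta>) / \<rho> \<Longrightarrow>
      \<rho> * max 0 (cos t) - \<bar>ln (norm \<beta>)\<bar> + ln (2/3) + ln \<bar>sin ((t + \<phi>) / 2)\<bar> + ln \<bar>sin ((t + - \<phi>) / 2)\<bar>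
      \<le> ln (norm (exp (of_real \<rho> * cis t) - \<beta>))"
proof -
  define w where "w = exp (of_real \<rho> * cis t)"
  define b where "b = ln (norm \<beta>)"
  define x where "x = \<rho> * cos t"
  have nw: "norm w = exp x" by (simp add: w_def norm_exp_cis x_def)
  have nb: "norm \<beta> = exp b" using assms by (simp add: b_def)
  have mx: "\<rho> * max 0 (cos t) = max 0 x" using \<rho> by (simp add: x_def max_mult_distrib_left)
  have "ln (norm (w - \<beta>)) \<le> max 0 x + ln (1 + norm \<beta>)"
  proof (cases "w = \<beta>")
    case False
    have "norm (w - \<beta>) \<le> exp x + norm \<beta>" using norm_triangle_ineq4[of w \<beta>] nw by simp
    also have "\<dots> \<le> exp (max 0 x) + exp (max 0 x) * norm \<beta>"
    proof (rule add_mono)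
      show "norm \<beta> \<le> exp (max 0 x) * norm \<beta>"
        using mult_right_mono[of 1 "exp (max 0 x)" "norm \<beta>"] by simp
    qed auto
    also have "\<dots> = exp (max 0 x) * (1 + norm \<beta>)" by (simp add: algebra_simps)
    finally have "ln (norm (w - \<beta>)) \<le> ln (exp (max 0 x) * (1 + norm \<beta>))"
      using False by (subst ln_le_cancel_iff) (auto intro!: mult_pos_pos add_pos_nonneg)
    also have "\<dots> = max 0 x + ln (1 + norm \<beta>)"
      using add_pos_nonneg[of 1 "norm \<beta>"] by (subst ln_mult) auto
    finally show ?thesis .
  qed (auto intro!: add_nonneg_nonneg)
  thus "ln (norm (exp (of_real \<rho> * cis t) - \<beta>)) \<le> \<rho> * max 0 (cos t) + ln (1 + norm \<beta>)"
    by (simp add: mx w_def)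
  assume t: "cos t \<noteq> ln (norm \<beta>) / \<rho>"
  have cphi: "cos \<phi> = b / \<rho>"
    unfolding \<phi>_def b_def using \<rho> by (intro cos_arccos) (auto simp: field_simps)
  define s1 s2 where "s1 = \<bar>sin ((t + \<phi>) / 2)\<bar>" and "s2 = \<bar>sin ((t + - \<phi>) / 2)\<bar>"
  define z where "z = \<bar>cos t - cos \<phi>\<bar>"
  have "sin ((\<phi> - t) / 2) = - sin ((t + - \<phi>) / 2)"
    by (metis (no_types, lifting) minus_diff_eq minus_divide_left sin_minus uminus_add_conv_diff add.commute)
  hence z: "z = 2 * s1 * s2"
    by (simp add: z_def cos_diff_cos s1_def s2_def abs_mult)
  have "z \<noteq> 0" using t cphi by (auto simp: z_def b_def)
  moreover have "z \<ge> 0" "z \<le> 2"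
    unfolding z_def using cos_ge_minus_one[of t] cos_le_one[of t] cos_ge_minus_one[of \<phi>] cos_le_one[of \<phi>] by linarith+
  ultimately have z0: "z > 0" "z \<le> 2" by auto
  have s: "s1 > 0" "s2 > 0" using z z0 by (auto simp: s1_def s2_def)
  have "x - b = \<rho> * (cos t - cos \<phi>)" using \<rho> by (simp add: x_def cphi field_simps)
  hence y: "\<bar>x - b\<bar> = \<rho> * z" using \<rho> by (simp add: z_def abs_mult)
  have "z \<le> \<rho> * z" using \<rho> z0 by simp
  \<comment> \<open>The constant 2/3 comes from z = 2 s1 s2 and z <= 2, hence z / (1 + z) >= z / 3.
    The exponent loses |b| because max x b >= max 0 x - |b|.\<close>
  have "exp (max 0 x - \<bar>b\<bar>) * (2/3 * s1 * s2) = exp (max 0 x - \<bar>b\<bar>) * (z / 3)" by (simp add: z)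
  also have "\<dots> \<le> exp (max x b) * (\<bar>x - b\<bar> / (1 + \<bar>x - b\<bar>))"
  proof (rule mult_mono)
    have "z / 3 \<le> z / (1 + z)" using z0 by (intro divide_left_mono) auto
    also have "\<dots> = 1 - 1 / (1 + z)" using z0 by (simp add: field_simps)
    also have "\<dots> \<le> 1 - 1 / (1 + \<rho> * z)"
      using \<open>z \<le> \<rho> * z\<close> z0 by (intro diff_left_mono divide_left_mono mult_pos_pos add_pos_pos) auto
    also have "\<dots> = \<rho> * z / (1 + \<rho> * z)"
    proof -
      have "1 + \<rho> * z > 0" using \<open>z \<le> \<rho> * z\<close> z0 by linarith
      thus ?thesis by (simp add: field_simps)
    qed
    finally show "z / 3 \<le> \<bar>x - b\<bar> / (1 + \<bar>x - b\<bar>)" by (simp add: y)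
  qed (use z0 in auto)
  also have "\<dots> \<le> \<bar>exp x - exp b\<bar>" by (rule abs_exp_diff_ge)
  also have "\<dots> \<le> norm (w - \<beta>)" using norm_triangle_ineq3[of w \<beta>] nw nb by simp
  finally have "exp (max 0 x - \<bar>b\<bar>) * (2/3 * s1 * s2) \<le> norm (w - \<beta>)" .
  moreover have "0 < exp (max 0 x - \<bar>b\<bar>) * (2/3 * s1 * s2)" using s by simp
  ultimately have "ln (exp (max 0 x - \<bar>b\<bar>) * (2/3 * s1 * s2)) \<le> ln (norm (w - \<beta>))"
    by (subst ln_le_cancel_iff) linarith+
  also have "ln (exp (max 0 x - \<bar>b\<bar>) * (2/3 * s1 * s2)) = max 0 x - \<bar>b\<bar> + ln (2/3) + ln s1 + ln s2"
    using s by (simp add: ln_mult ln_div)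
  finally show "\<rho> * max 0 (cos t) - \<bar>ln (norm \<beta>)\<bar> + ln (2/3) + ln \<bar>sin ((t + \<phi>) / 2)\<bar> + ln \<bar>sin ((t + - \<phi>) / 2)\<bar>
      \<le> ln (norm (exp (of_real \<rho> * cis t) - \<beta>))"
    by (simp add: mx w_def s1_def s2_def b_def)
qed

text \<open>In the pointwise bounds \<rho> max 0 (cos t) contributes 2 \<rho>; the rest is bounded
  uniformly in \<rho>, since \<phi> enters only through integrals bounded below by - K. For \<beta>
  = 0, log |w| = \<rho> cos t has mean 0.\<close>

lemma log_dist_exp_integral:
  fixes \<beta> :: complex
  shows "\<exists>C \<rho>0. \<forall>\<rho>\<ge>\<rho>0. (\<lambda>t. ln (norm (exp (of_real \<rho> * cis t) - \<beta>))) integrable_on {0..2*pi} \<and>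
     \<bar>integral {0..2*pi} (\<lambda>t. ln (norm (exp (of_real \<rho> * cis t) - \<beta>))) - (if \<beta> = 0 then 0 else 2 * \<rho>)\<bar> \<le> C"
proof (cases "\<beta> = 0")
  case True
  thus ?thesis using log_norm_exp_integral by (force simp: has_integral_integrable integral_unique)
next
  case False
  from ln_abs_sin_shift obtain K where
    K: "\<And>\<phi>. \<phi> \<in> {-pi..pi} \<Longrightarrow> (\<lambda>t::real. ln \<bar>sin ((t + \<phi>) / 2)\<bar>) integrable_on {0..2*pi}"
       "\<And>\<phi>. \<phi> \<in> {-pi..pi} \<Longrightarrow> - K \<le> integral {0..2*pi} (\<lambda>t. ln \<bar>sin ((t + \<phi>) / 2)\<bar>)"
    by blast
  define b where "b = ln (norm \<beta>)"
  define C where "C = max (2 * pi * ln (1 + norm \<beta>)) (2 * pi * (\<bar>b\<bar> - ln (2/3)) + 2 * K)"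
  have "(\<lambda>t. ln (norm (exp (of_real \<rho> * cis t) - \<beta>))) integrable_on {0..2*pi} \<and>
     \<bar>integral {0..2*pi} (\<lambda>t. ln (norm (exp (of_real \<rho> * cis t) - \<beta>))) - 2 * \<rho>\<bar> \<le> C"
    \<comment> \<open>Ensures that b / \<rho> lies in [-1, 1], so that its arccos is a genuine
      angle.\<close>
    if "\<rho> \<ge> max 1 \<bar>b\<bar>" for \<rho>
  proof -
    have \<rho>: "\<rho> \<ge> 1" "\<bar>ln (norm \<beta>)\<bar> \<le> \<rho>" using that by (auto simp: b_def)
    define \<phi> where "\<phi> = arccos (b / \<rho>)"
    have \<phi>: "\<phi> \<in> {-pi..pi}" "- \<phi> \<in> {-pi..pi}"
      unfolding \<phi>_def using arccos_bounded[of "b/\<rho>"] \<rho> pi_ge_zero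
      by (auto simp: b_def field_simps intro: order_trans[of _ 0])
    define u where "u = (\<lambda>t. ln (norm (exp (of_real \<rho> * cis t) - \<beta>)))"
    define L where "L = (\<lambda>t. \<rho> * max 0 (cos t) - \<bar>b\<bar> + ln (2/3) + ln \<bar>sin ((t + \<phi>) / 2)\<bar> + ln \<bar>sin ((t + - \<phi>) / 2)\<bar>)"
    define U where "U = (\<lambda>t. \<rho> * max 0 (cos t) + ln (1 + norm \<beta>))"
    have "(L has_integral (\<rho> * 2 - 2*pi * \<bar>b\<bar> + 2*pi * ln (2/3) + integral {0..2*pi} (\<lambda>t. ln \<bar>sin ((t + \<phi>) / 2)\<bar>)
            + integral {0..2*pi} (\<lambda>t. ln \<bar>sin ((t + - \<phi>) / 2)\<bar>))) {0..2*pi}"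
      unfolding L_def
      by (intro has_integral_add has_integral_diff has_integral_mult_right integral_max_cos
           integrable_integral K \<phi>)
         (use has_integral_const_real[of "\<bar>b\<bar>" 0 "2*pi"] has_integral_const_real[of "ln (2/3)::real" 0 "2*pi"] in simp_all)
    hence L: "L integrable_on {0..2*pi}" "integral {0..2*pi} L \<ge> 2 * \<rho> - (2 * pi * (\<bar>b\<bar> - ln (2/3)) + 2 * K)"
      using K(2)[OF \<phi>(1)] K(2)[OF \<phi>(2)] by (auto simp: integral_unique algebra_simps)
    have "(U has_integral (\<rho> * 2 + 2*pi * ln (1 + norm \<beta>))) {0..2*pi}"
      unfolding U_def
      by (intro has_integral_add has_integral_mult_right integral_max_cos)
         (use has_integral_const_real[of "ln (1 + norm \<beta>)" 0 "2*pi"] in simp_all)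
    hence U: "U integrable_on {0..2*pi}" "integral {0..2*pi} U = 2 * \<rho> + 2 * pi * ln (1 + norm \<beta>)"
      by (auto simp: integral_unique)
    have meas: "u \<in> borel_measurable borel"
    proof -
      have "(\<lambda>t. norm (exp (of_real \<rho> * cis t) - \<beta>)) \<in> borel_measurable borel"
        by (intro borel_measurable_continuous_onI continuous_intros)
      thus ?thesis unfolding u_def by measurable
    qed
    have bd: "L t \<le> u t \<and> u t \<le> U t" if "t \<in> {0..2*pi} - {t \<in> {0..2*pi}. cos t = b / \<rho>}" for t
      using log_dist_exp_bounds[OF False \<rho>, of t] that
      by (auto simp: L_def U_def u_def b_def \<phi>_def)
    note * = integral_between[OF meas L(1) U(1) finite_cos_eq[of "b / \<rho>"] bd]
    from *(2,3) L(2) U(2) have "\<bar>integral {0..2*pi} u - 2 * \<rho>\<bar> \<le> C" unfolding C_def by linarith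
    with *(1) show ?thesis by (simp add: u_def)
  qed
  thus ?thesis using False by (intro exI[of _ C] exI[of _ "max 1 \<bar>b\<bar>"]) auto
qed

lemma finite_poly_exp_zeros:
  assumes "p \<noteq> 0" "\<rho> > 0"
  shows "finite {t \<in> {0..2*pi}. poly p (exp (of_real \<rho> * cis t)) = 0}"
proof (rule finite_subset)
  show "{t \<in> {0..2*pi}. poly p (exp (of_real \<rho> * cis t)) = 0} \<subseteq>
    (\<Union>z\<in>{z. poly p z = 0}. {t \<in> {0..2*pi}. cos t = ln (norm z) / \<rho>})"
    using assms norm_exp_cis by auto
  show "finite (\<Union>z\<in>{z. poly p z = 0}. {t \<in> {0..2*pi}. cos t = ln (norm z) / \<rho>})"
    using assms by (intro finite_UN_I poly_roots_finite finite_cos_eq)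
qed

lemma log_poly_exp_integral:
  fixes p :: "complex poly"
  assumes "p \<noteq> 0"
  shows "\<exists>C \<rho>0. \<forall>\<rho>\<ge>\<rho>0. (\<lambda>t. ln (norm (poly p (exp (of_real \<rho> * cis t))))) integrable_on {0..2*pi} \<and>
     \<bar>integral {0..2*pi} (\<lambda>t. ln (norm (poly p (exp (of_real \<rho> * cis t))))) -
        2 * \<rho> * real (\<Sum>z | z \<noteq> 0 \<and> poly p z = 0. order z p)\<bar> \<le> C"
proof -
  define Z where "Z = {z. poly p z = 0}"
  have Z: "finite Z" unfolding Z_def by (rule poly_roots_finite[OF assms])
  define I where "I = (\<lambda>\<rho> z. integral {0..2*pi} (\<lambda>t. ln (norm (exp (of_real \<rho> * cis t) - z))))"
  obtain C R where CR: "\<And>z \<rho>. \<rho> \<ge> R z \<Longrightarrow> (\<lambda>t. ln (norm (exp (of_real \<rho> * cis t) - z))) integrable_on {0..2*pi} \<and>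
     \<bar>I \<rho> z - (if z = 0 then 0 else 2 * \<rho>)\<bar> \<le> C z"
    unfolding I_def using log_dist_exp_integral by metis
  \<comment> \<open>The sum dominates the threshold R z of every root at once, and the 1 keeps
    \<rho> positive.\<close>
  define \<rho>0 where "\<rho>0 = 1 + (\<Sum>z\<in>Z. \<bar>R z\<bar>)"
  define D where "D = 2*pi * \<bar>ln (norm (lead_coeff p))\<bar> + (\<Sum>z\<in>Z. real (order z p) * C z)"
  have "(\<lambda>t. ln (norm (poly p (exp (of_real \<rho> * cis t))))) integrable_on {0..2*pi} \<and>
     \<bar>integral {0..2*pi} (\<lambda>t. ln (norm (poly p (exp (of_real \<rho> * cis t))))) -
        2 * \<rho> * real (\<Sum>z | z \<noteq> 0 \<and> poly p z = 0. order z p)\<bar> \<le> D" if \<rho>: "\<rho> \<ge> \<rho>0" for \<rho>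
  proof -
    have "\<rho> \<ge> 1" 
    proof -
      have "0 \<le> (\<Sum>z\<in>Z. \<bar>R z\<bar>)" by (rule sum_nonneg) auto
      thus ?thesis using \<rho> unfolding \<rho>0_def by linarith
    qed
    have R: "R z \<le> \<rho>" if "z \<in> Z" for z
      using member_le_sum[OF that, of "\<lambda>z. \<bar>R z\<bar>"] Z \<rho> by (simp add: \<rho>0_def)
    define J where "J = 2*pi * ln (norm (lead_coeff p)) + (\<Sum>z\<in>Z. real (order z p) * I \<rho> z)"
    have "((\<lambda>t. ln (norm (lead_coeff p)) + (\<Sum>z\<in>Z. real (order z p) * ln (norm (exp (of_real \<rho> * cis t) - z))))
           has_integral J) {0..2*pi}"
      unfolding J_def I_def
      by (intro has_integral_add has_integral_sum Z has_integral_mult_right integrable_integral)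
         (use has_integral_const_real[of "ln (norm (lead_coeff p))" 0 "2*pi"] CR R in auto)
    hence int: "((\<lambda>t. ln (norm (poly p (exp (of_real \<rho> * cis t))))) has_integral J) {0..2*pi}"
    \<comment> \<open>Splitting the logarithm of the product may fail at roots of p on the circle,
      because of \<open>ln 0 = 0\<close>; these are finitely many.\<close>
    proof (rule has_integral_spike_finite[rotated 2])
      show "finite {t \<in> {0..2*pi}. poly p (exp (of_real \<rho> * cis t)) = 0}"
        using finite_poly_exp_zeros[of p \<rho>] assms \<open>\<rho> \<ge> 1\<close> by simp
      show "ln (norm (poly p (exp (of_real \<rho> * cis t)))) =
        ln (norm (lead_coeff p)) + (\<Sum>z\<in>Z. real (order z p) * ln (norm (exp (of_real \<rho> * cis t) - z)))"
        if "t \<in> {0..2*pi} - {t \<in> {0..2*pi}. poly p (exp (of_real \<rho> * cis t)) = 0}" for t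
      proof -
        define w where "w = exp (of_real \<rho> * cis t)"
        have w: "poly p w \<noteq> 0" using that by (auto simp: w_def)
        hence nz: "w - z \<noteq> 0" if "z \<in> Z" for z using that by (auto simp: Z_def)
        have "poly p w = lead_coeff p * (\<Prod>z\<in>Z. (w - z) ^ order z p)"
          by (subst complex_poly_decompose[symmetric]) (simp add: poly_prod Z_def)
        hence "ln (norm (poly p w)) = ln (norm (lead_coeff p) * (\<Prod>z\<in>Z. norm (w - z) ^ order z p))"
          by (simp add: norm_mult prod_norm[symmetric] norm_power)
        also have "\<dots> = ln (norm (lead_coeff p)) + ln (\<Prod>z\<in>Z. norm (w - z) ^ order z p)"
          using assms nz by (intro ln_mult_pos prod_pos) auto
        also have "ln (\<Prod>z\<in>Z. norm (w - z) ^ order z p) = (\<Sum>z\<in>Z. ln (norm (w - z) ^ order z p))"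
          using nz Z by (intro ln_prod) auto
        also have "\<dots> = (\<Sum>z\<in>Z. real (order z p) * ln (norm (w - z)))"
          using nz by (intro sum.cong) (auto simp: ln_realpow)
        finally show ?thesis by (simp add: w_def)
      qed
    qed
    have "(\<Sum>z\<in>Z. real (order z p) * (if z = 0 then 0 else 2 * \<rho>)) =
          (\<Sum>z | z \<noteq> 0 \<and> poly p z = 0. 2 * \<rho> * real (order z p))"
      by (rule sum.mono_neutral_cong_right) (use Z in \<open>auto simp: Z_def\<close>)
    hence "J - 2 * \<rho> * real (\<Sum>z | z \<noteq> 0 \<and> poly p z = 0. order z p) =
        2*pi * ln (norm (lead_coeff p)) + (\<Sum>z\<in>Z. real (order z p) * (I \<rho> z - (if z = 0 then 0 else 2 * \<rho>)))"
      by (simp add: J_def right_diff_distrib sum_subtractf sum_distrib_left)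
    moreover have "\<bar>\<Sum>z\<in>Z. real (order z p) * (I \<rho> z - (if z = 0 then 0 else 2 * \<rho>))\<bar> \<le>
        (\<Sum>z\<in>Z. real (order z p) * C z)"
    proof (rule order_trans[OF sum_abs], rule sum_mono)
      fix z assume "z \<in> Z"
      hence "\<bar>I \<rho> z - (if z = 0 then 0 else 2 * \<rho>)\<bar> \<le> C z" using CR R by blast
      hence "real (order z p) * \<bar>I \<rho> z - (if z = 0 then 0 else 2 * \<rho>)\<bar> \<le> real (order z p) * C z"
        by (rule mult_left_mono) simp
      thus "\<bar>real (order z p) * (I \<rho> z - (if z = 0 then 0 else 2 * \<rho>))\<bar> \<le> real (order z p) * C z"
        by (simp only: abs_mult abs_of_nat)
    qed
    moreover have "\<bar>2*pi * ln (norm (lead_coeff p))\<bar> = 2*pi * \<bar>ln (norm (lead_coeff p))\<bar>"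
      by (simp add: abs_mult)
    ultimately have "\<bar>J - 2 * \<rho> * real (\<Sum>z | z \<noteq> 0 \<and> poly p z = 0. order z p)\<bar> \<le> D"
      unfolding D_def by linarith
    with int show ?thesis by (simp add: has_integral_iff)
  qed
  thus ?thesis by blast
qed

text \<open>
  Expresses \<open>u\<^sup>n p(1/u)\<close>, that is \<open>p\<close> in the chart at infinity, when \<open>degree p \<le> n\<close>.
\<close>

definition rev_poly :: "nat \<Rightarrow> 'a::field poly \<Rightarrow> 'a poly" where
  "rev_poly n p = monom 1 (n - degree p) * reflect_poly p"

lemma poly_rev_poly:
  assumes "degree p \<le> n"
  shows "poly (rev_poly n p) v = (if v = 0 then coeff p n else v ^ n * poly p (inverse v))"
proof (cases "v = 0")
  case True
  thus ?thesis
    using assms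
    by (cases "degree p = n") (simp_all add: rev_poly_def poly_monom power_0_left coeff_eq_0 poly_reflect_poly_0)
next
  case False
  have "v ^ (n - degree p) * v ^ degree p = v ^ n"
    using assms by (simp add: power_add[symmetric])
  thus ?thesis using False by (simp add: rev_poly_def poly_monom poly_reflect_poly_nz mult.assoc[symmetric])
qed

text \<open>The monomial factor accounts for the whole order: the constant term of
  \<open>reflect_poly p\<close> is the leading coefficient of p.\<close>

lemma order_rev_poly:
  assumes "p \<noteq> 0"
  shows "order 0 (rev_poly n p) = n - degree p"
proof -
  have "order 0 (monom (1::'a) k) = k" for k
    using order_0_monom[of "1::'a" k] by simp
  moreover have "order 0 (reflect_poly p) = 0"
    using assms by (intro order_0I) (simp add: poly_0_coeff_0)
  ultimately show ?thesis using assms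
    unfolding rev_poly_def by (subst order_mult) auto
qed

lemma rev_poly_nz: "p \<noteq> 0 \<Longrightarrow> rev_poly n p \<noteq> 0"
  by (simp add: rev_poly_def)

text \<open>Coprimality keeps the maximum positive on the compact unit disc, so its logarithm is
  bounded there. Outside, inversion leads to the reversed pair, which has no common zero in the disc
  either, and the factor w^n produces n log |w|.\<close>

lemma log_max_poly_bounded:
  fixes p q :: "complex poly"
  assumes "coprime p q" and n: "n = max (degree p) (degree q)"
  shows "\<exists>C. \<forall>w. \<bar>ln (max (norm (poly p w)) (norm (poly q w))) - real n * ln (max 1 (norm w))\<bar> \<le> C"
proof -
  have pos: "max (norm (poly p w)) (norm (poly q w)) > 0" for w
    using coprime_poly_0[OF assms(1), of w] by (auto simp: less_max_iff_disj)
  have pos': "max (norm (poly (rev_poly n p) w)) (norm (poly (rev_poly n q) w)) > 0" for w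
  proof (cases "w = 0")
    case True
    \<comment> \<open>At infinity the reversed pair does not vanish, because one of p, q is nonzero
      of degree exactly n.\<close>
    have "coeff p n \<noteq> 0 \<or> coeff q n \<noteq> 0"
    proof (rule ccontr)
      assume "\<not> ?thesis"
      hence "coeff p n = 0" "coeff q n = 0" by auto
      moreover from this have "p = 0" if "n = degree p" using that by auto
      moreover from calculation have "q = 0" if "n = degree q" using that by auto
      ultimately have "p = 0 \<and> q = 0"
        using n by (cases "degree p \<le> degree q") (auto simp: max_def)
      thus False using pos[of 0] by auto
    qed
    thus ?thesis using True n by (auto simp: poly_rev_poly less_max_iff_disj)
  next
    case False
    thus ?thesis using n pos[of "inverse w"] by (auto simp: poly_rev_poly less_max_iff_disj)
  qed
  have bdd: "\<exists>C. \<forall>w\<in>cball 0 1. \<bar>ln (max (norm (poly a w)) (norm (poly b w)))\<bar> \<le> C"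
    if "\<And>w. max (norm (poly a w)) (norm (poly b w)) > 0" for a b :: "complex poly"
  proof -
    have nz: "max (norm (poly a w)) (norm (poly b w)) \<noteq> 0" for w
      using that[of w] by linarith
    have "compact ((\<lambda>w. ln (max (norm (poly a w)) (norm (poly b w)))) ` cball 0 1)"
      by (intro compact_continuous_image continuous_intros ballI nz compact_cball)
    from compact_imp_bounded[OF this] show ?thesis by (auto simp: bounded_iff)
  qed
  obtain C1 where C1: "\<And>w. norm w \<le> 1 \<Longrightarrow> \<bar>ln (max (norm (poly p w)) (norm (poly q w)))\<bar> \<le> C1"
    using bdd[OF pos] by (metis mem_cball_0)
  obtain C2 where C2: "\<And>w. norm w \<le> 1 \<Longrightarrow>
      \<bar>ln (max (norm (poly (rev_poly n p) w)) (norm (poly (rev_poly n q) w)))\<bar> \<le> C2"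
    using bdd[OF pos'] by (metis mem_cball_0)
  have "\<bar>ln (max (norm (poly p w)) (norm (poly q w))) - real n * ln (max 1 (norm w))\<bar> \<le> max C1 C2" for w
  proof (cases "norm w \<le> 1")
    case True
    thus ?thesis using C1[OF True] by (simp add: max_absorb1 le_max_iff_disj)
  next
    case False
    hence w: "w \<noteq> 0" "norm w > 1" by auto
    have "max (norm (poly (rev_poly n p) (inverse w))) (norm (poly (rev_poly n q) (inverse w))) =
      inverse (norm w ^ n) * max (norm (poly p w)) (norm (poly q w))"
      using w n by (simp add: poly_rev_poly norm_mult norm_inverse norm_power power_inverse max_mult_distrib_left)
    hence "ln (max (norm (poly (rev_poly n p) (inverse w))) (norm (poly (rev_poly n q) (inverse w)))) =
      ln (inverse (norm w ^ n)) + ln (max (norm (poly p w)) (norm (poly q w)))"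
      using w pos[of w] by (simp add: ln_mult_pos)
    also have "ln (inverse (norm w ^ n)) = - real n * ln (norm w)"
      using w by (simp add: ln_inverse ln_realpow)
    finally have "\<bar>ln (max (norm (poly p w)) (norm (poly q w))) - real n * ln (norm w)\<bar> \<le> C2"
      using C2[of "inverse w"] w by (simp add: norm_inverse inverse_le_1_iff)
    thus ?thesis using w by (simp add: max_def)
  qed
  thus ?thesis by blast
qed

lemma log_max_poly_exp_integral:
  fixes p q :: "complex poly"
  assumes "coprime p q" and n: "n = max (degree p) (degree q)"
  shows "\<exists>C. \<forall>\<rho>\<ge>0. (\<lambda>t. ln (max (norm (poly p (exp (of_real \<rho> * cis t)))) (norm (poly q (exp (of_real \<rho> * cis t))))))
        integrable_on {0..2*pi} \<and>
     \<bar>integral {0..2*pi} (\<lambda>t. ln (max (norm (poly p (exp (of_real \<rho> * cis t)))) (norm (poly q (exp (of_real \<rho> * cis t))))))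
        - 2 * \<rho> * real n\<bar> \<le> C"
proof -
  obtain C where C: "\<And>w. \<bar>ln (max (norm (poly p w)) (norm (poly q w))) - real n * ln (max 1 (norm w))\<bar> \<le> C"
    using log_max_poly_bounded[OF assms] by blast
  show ?thesis
  proof (intro exI allI impI)
    fix \<rho> :: real assume \<rho>: "\<rho> \<ge> 0"
    define u where "u = (\<lambda>t. ln (max (norm (poly p (exp (of_real \<rho> * cis t)))) (norm (poly q (exp (of_real \<rho> * cis t))))))"
    have pos: "max (norm (poly p w)) (norm (poly q w)) > 0" for w
      using coprime_poly_0[OF assms(1), of w] by (auto simp: less_max_iff_disj)
    have int: "((\<lambda>t. real n * (\<rho> * max 0 (cos t)) + c) has_integral (real n * (\<rho> * 2) + 2 * pi * c)) {0..2*pi}" for c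
      by (intro has_integral_add has_integral_mult_right integral_max_cos)
         (use has_integral_const_real[of c 0 "2*pi"] in simp_all)
    have nz: "max (norm (poly p w)) (norm (poly q w)) \<noteq> 0" for w
      using pos[of w] by linarith
    have "continuous_on {0..2*pi} u"
      unfolding u_def by (intro continuous_intros ballI nz)
    hence ui: "u integrable_on {0..2*pi}" by (rule integrable_continuous_interval)
    have b: "real n * (\<rho> * max 0 (cos t)) + (-C) \<le> u t \<and> u t \<le> real n * (\<rho> * max 0 (cos t)) + C" for t
    proof -
      have "ln (max 1 (exp (\<rho> * cos t))) = \<rho> * max 0 (cos t)"
        using \<rho> by (auto simp: max_def mult_le_0_iff zero_le_mult_iff)
      thus ?thesis using C[of "exp (of_real \<rho> * cis t)"] unfolding norm_exp_cis by (simp add: u_def abs_le_iff)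
    qed
    have "real n * (\<rho> * 2) + 2 * pi * (-C) \<le> integral {0..2*pi} u"
      by (rule has_integral_le[OF int integrable_integral[OF ui]]) (use b in blast)
    moreover have "integral {0..2*pi} u \<le> real n * (\<rho> * 2) + 2 * pi * C"
      by (rule has_integral_le[OF integrable_integral[OF ui] int]) (use b in blast)
    ultimately show "u integrable_on {0..2*pi} \<and> \<bar>integral {0..2*pi} u - 2 * \<rho> * real n\<bar> \<le> 2 * pi * C"
      using ui by (simp add: abs_le_iff algebra_simps)
  qed
qed

section \<open>The proximity function m(r, f)\<close>

lemma coprime_rat: "coprime (rat_num S) (rat_den S)"
  unfolding rat_num_def rat_den_def by (rule coprime_quot_of_fract)

lemma rat_den_nz [simp]: "rat_den S \<noteq> 0"
  by (simp add: rat_den_def)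

lemma nev_m_asymp:
  fixes q n :: nat and S :: "complex poly fract"
  assumes q: "q \<ge> 1" and n: "rat_degree S = n"
  defines "f \<equiv> (\<lambda>z. rat_map S (Fin (exp (z / of_nat q))))"
  defines "M \<equiv> \<Sum>z | z \<noteq> 0 \<and> poly (rat_den S) z = 0. order z (rat_den S)"
  shows "\<exists>C. \<forall>\<^sub>F r in at_top. \<bar>nev_m r f - (real n - real M) / (pi * real q) * r\<bar> \<le> C"
proof -
  define P Q where "P = rat_num S" and "Q = rat_den S"
  have cop: "coprime P Q" and nPQ: "n = max (degree P) (degree Q)"
    using coprime_rat[of S] n by (simp_all add: P_def Q_def rat_degree_def)
  obtain C1 where C1: "\<And>\<rho>. \<rho> \<ge> 0 \<Longrightarrow>
     (\<lambda>t. ln (max (norm (poly P (exp (of_real \<rho> * cis t)))) (norm (poly Q (exp (of_real \<rho> * cis t))))))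
        integrable_on {0..2*pi} \<and>
     \<bar>integral {0..2*pi} (\<lambda>t. ln (max (norm (poly P (exp (of_real \<rho> * cis t)))) (norm (poly Q (exp (of_real \<rho> * cis t))))))
        - 2 * \<rho> * real n\<bar> \<le> C1"
    using log_max_poly_exp_integral[OF cop nPQ] by blast
  obtain C2 \<rho>0 where C2: "\<And>\<rho>. \<rho> \<ge> \<rho>0 \<Longrightarrow>
     (\<lambda>t. ln (norm (poly Q (exp (of_real \<rho> * cis t))))) integrable_on {0..2*pi} \<and>
     \<bar>integral {0..2*pi} (\<lambda>t. ln (norm (poly Q (exp (of_real \<rho> * cis t))))) - 2 * \<rho> * real M\<bar> \<le> C2"
    using log_poly_exp_integral[OF rat_den_nz, of S] unfolding M_def Q_def by blast
  have "\<bar>nev_m r f - (real n - real M) / (pi * real q) * r\<bar> \<le> (C1 + C2) / (2 * pi)"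
    if r: "r > 0" "r / q \<ge> \<rho>0" for r
  proof -
    define \<rho> where "\<rho> = r / q"
    have \<rho>: "\<rho> > 0" "\<rho> \<ge> \<rho>0" using r q by (auto simp: \<rho>_def)
    define W where "W = (\<lambda>t. exp (of_real \<rho> * cis t))"
    define I1 where "I1 = integral {0..2*pi} (\<lambda>t. ln (max (norm (poly P (W t))) (norm (poly Q (W t)))))"
    define I2 where "I2 = integral {0..2*pi} (\<lambda>t. ln (norm (poly Q (W t))))"
    have "((\<lambda>t. ln (max (norm (poly P (W t))) (norm (poly Q (W t)))) - ln (norm (poly Q (W t)))) has_integral (I1 - I2)) {0..2*pi}"
      unfolding I1_def I2_def W_def
      by (intro has_integral_diff integrable_integral) (use C1[of \<rho>] C2[of \<rho>] \<rho> in auto)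
    hence "((\<lambda>t. log_plus (norm (coord (f (of_real r * cis t))))) has_integral (I1 - I2)) {0..2*pi}"
    proof (rule has_integral_spike_finite[rotated 2])
      \<comment> \<open>These are the poles of f on the circle, where \<open>coord\<close> has its
        dummy value.\<close>
      show "finite {t \<in> {0..2*pi}. poly Q (exp (of_real \<rho> * cis t)) = 0}"
        using \<rho> by (intro finite_poly_exp_zeros) (auto simp: Q_def)
      show "log_plus (norm (coord (f (of_real r * cis t)))) =
         ln (max (norm (poly P (W t))) (norm (poly Q (W t)))) - ln (norm (poly Q (W t)))"
        if "t \<in> {0..2*pi} - {t \<in> {0..2*pi}. poly Q (exp (of_real \<rho> * cis t)) = 0}" for t
      proof -
        have nz: "poly Q (W t) \<noteq> 0" using that by (auto simp: W_def)
        have "of_real r * cis t / of_nat q = of_real \<rho> * cis t" by (simp add: \<rho>_def)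
        hence "coord (f (of_real r * cis t)) = poly P (W t) / poly Q (W t)"
          using nz by (simp add: f_def rat_map_def P_def Q_def W_def)
        moreover have "log_plus (a / b) = ln (max a b) - ln b" if "a \<ge> 0" "b > 0" for a b :: real
        proof (cases "a = 0")
          case False
          thus ?thesis using that by (auto simp: log_plus_def max_def ln_div)
        qed (use that in \<open>auto simp: log_plus_def max_def\<close>)
        ultimately show ?thesis using nz by (simp add: norm_divide)
      qed
    qed
    hence "nev_m r f = (I1 - I2) / (2 * pi)"
      unfolding nev_m_def by (simp add: integral_unique)
    moreover have "(real n - real M) / (pi * real q) * r = (2 * \<rho> * real n - 2 * \<rho> * real M) / (2 * pi)"
      using q by (simp add: \<rho>_def field_simps)
    ultimately have "nev_m r f - (real n - real M) / (pi * real q) * r =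
        ((I1 - 2 * \<rho> * real n) - (I2 - 2 * \<rho> * real M)) / (2 * pi)"
      by (simp add: diff_divide_distrib)
    also have "\<bar>\<dots>\<bar> \<le> (C1 + C2) / (2 * pi)"
    proof -
      have "\<bar>I1 - 2 * \<rho> * real n\<bar> \<le> C1" "\<bar>I2 - 2 * \<rho> * real M\<bar> \<le> C2"
        using C1[of \<rho>] C2[of \<rho>] \<rho> by (auto simp: I1_def I2_def W_def)
      thus ?thesis by (simp add: divide_right_mono)
    qed
    finally show ?thesis .
  qed
  note * = this
  have "\<forall>\<^sub>F r in at_top. \<bar>nev_m r f - (real n - real M) / (pi * real q) * r\<bar> \<le> (C1 + C2) / (2 * pi)"
    using eventually_gt_at_top[of 0] eventually_ge_at_top[of "\<rho>0 * q"]
  proof eventually_elim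
    case (elim r)
    thus ?case using q by (intro *) (auto simp: pos_le_divide_eq)
  qed
  thus ?thesis by blast
qed

section \<open>Multiplicities of rational maps\<close>

definition proj_point :: "complex \<Rightarrow> complex \<Rightarrow> csphere" where
  "proj_point p q = (if q = 0 then Infty else Fin (p / q))"

text \<open>
  The equation of the fibre over \<open>a\<close> in the homogeneous coordinates \<open>(p : q)\<close>; being linear, it treats
  both charts of the sphere and the reversal of polynomials uniformly.
\<close>

definition fiber_form :: "csphere \<Rightarrow> complex \<Rightarrow> complex \<Rightarrow> complex" where
  "fiber_form a p q = (case a of Fin c \<Rightarrow> p - c * q | Infty \<Rightarrow> q)"

text \<open>The member of the pencil of P and Q that vanishes on the finite part of the fibre over
  \<open>a\<close>. Its degree falls short of \<open>rat_degree S\<close> by the multiplicity with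
  which \<open>Infty\<close> belongs to the fibre.\<close>

definition fiber_poly :: "complex poly fract \<Rightarrow> csphere \<Rightarrow> complex poly" where
  "fiber_poly S a = (case a of Fin c \<Rightarrow> rat_num S - smult c (rat_den S) | Infty \<Rightarrow> rat_den S)"

lemma proj_point_eq_iff:
  assumes "p \<noteq> 0 \<or> q \<noteq> 0"
  shows "proj_point p q = a \<longleftrightarrow> fiber_form a p q = 0"
  using assms by (cases a) (auto simp: proj_point_def fiber_form_def field_simps)

text \<open>In the chart centred at \<open>F z\<close> the map is the fibre equation divided by a
  coordinate \<open>h\<close> that does not vanish at z: p at a pole, q otherwise. Such a division
  leaves the order m unchanged.\<close>

lemma local_mult_proj_point:
  assumes S: "open S" "z \<in> S" "p holomorphic_on S" "q holomorphic_on S" "g holomorphic_on S"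
    and nz: "p z \<noteq> 0 \<or> q z \<noteq> 0" and g: "g z \<noteq> 0"
    and F: "\<And>w. w \<in> S \<Longrightarrow> F w = proj_point (p w) (q w)"
    and eq: "\<And>w. w \<in> S \<Longrightarrow> fiber_form (F z) (p w) (q w) = g w * (w - z) ^ m"
  shows "local_mult F z = m"
proof -
  define h where "h = (if q z = 0 then p else q)"
  have h: "h holomorphic_on S" "h z \<noteq> 0" using assms by (auto simp: h_def)
  define U where "U = S \<inter> h -` (-{0})"
  have U: "open U" "z \<in> U"
    unfolding U_def using h S
    by (auto intro!: continuous_open_preimage holomorphic_on_imp_continuous_on)
  have gh: "(\<lambda>w. g w / h w) holomorphic_on U"
    by (intro holomorphic_intros; (rule holomorphic_on_subset[of _ S])?) (use S h in \<open>auto simp: U_def\<close>)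
  show ?thesis
  proof (cases "q z = 0")
    case True
    have "F z = Infty" using F[OF S(2)] True by (simp add: proj_point_def)
    have "zorder (\<lambda>w. coord (recip (F w))) z = int m"
    proof (rule zorder_eqI[OF U gh])
      show "g z / h z \<noteq> 0" using g h by simp
      fix w assume w: "w \<in> U"
      have "p w \<noteq> 0" using w True by (auto simp: U_def h_def)
      have "coord (recip (F w)) = q w / p w"
        using F[of w] w \<open>p w \<noteq> 0\<close> by (auto simp: U_def proj_point_def)
      also have "q w = g w * (w - z) ^ m"
        using eq[of w] w \<open>F z = Infty\<close> by (simp add: fiber_form_def U_def)
      finally show "coord (recip (F w)) = g w / h w * (w - z) powi int m"
        using True by (simp add: h_def)
    qed
    thus ?thesis using \<open>F z = Infty\<close> by (simp add: local_mult_def)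
  next
    case False
    define c where "c = p z / q z"
    have Fz: "F z = Fin c" using F[OF S(2)] False by (simp add: proj_point_def c_def)
    have "zorder (\<lambda>w. coord (F w) - c) z = int m"
    proof (rule zorder_eqI[OF U gh])
      show "g z / h z \<noteq> 0" using g h by simp
      fix w assume w: "w \<in> U"
      have "q w \<noteq> 0" using w False by (auto simp: U_def h_def)
      hence "coord (F w) - c = (p w - c * q w) / q w"
        using F[of w] w by (auto simp: U_def proj_point_def field_simps)
      also have "p w - c * q w = g w * (w - z) ^ m"
        using eq[of w] w Fz by (simp add: fiber_form_def U_def)
      finally show "coord (F w) - c = g w / h w * (w - z) powi int m"
        using False by (simp add: h_def)
    qed
    thus ?thesis using Fz by (simp add: local_mult_def)
  qed
qed

text \<open>One argument for three situations: S at a finite point and at infinity, with g the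
  identity, and f, with g an exponential. Because g'(z) is nonzero, u - g(z) pulls back to w - z
  times a factor nonzero at z, so the order of the root is preserved.\<close>

lemma local_mult_proj_point_compose:
  fixes p q R :: "complex poly" and g :: "complex \<Rightarrow> complex"
  assumes nz: "poly p (g z) \<noteq> 0 \<or> poly q (g z) \<noteq> 0"
    and F: "\<And>w. F w = proj_point (poly p (g w)) (poly q (g w))"
    and R: "R \<noteq> 0" "\<And>w. poly R (g w) = fiber_form (F z) (poly p (g w)) (poly q (g w))"
    and g: "g holomorphic_on UNIV" "deriv g z \<noteq> 0"
  shows "local_mult F z = order (g z) R"
proof -
  define m where "m = order (g z) R"
  obtain K where K: "R = [:- g z, 1:] ^ m * K" "\<not> [:- g z, 1:] dvd K"
    using order_decomp[OF R(1), of "g z"] by (auto simp: m_def)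
  define h where "h = (\<lambda>w. if w = z then deriv g z else (g w - g z) / (w - z))"
  have h: "h holomorphic_on UNIV" unfolding h_def by (rule pole_lemma[OF g(1)]) auto
  have gh: "g w - g z = h w * (w - z)" for w by (simp add: h_def)
  show ?thesis unfolding m_def[symmetric]
  proof (rule local_mult_proj_point[where S = UNIV and g = "\<lambda>w. poly K (g w) * h w ^ m"
           and p = "\<lambda>w. poly p (g w)" and q = "\<lambda>w. poly q (g w)"])
    show "poly K (g z) * h z ^ m \<noteq> 0"
      using K(2) g(2) by (simp add: h_def poly_eq_0_iff_dvd)
    show "fiber_form (F z) (poly p (g w)) (poly q (g w)) = poly K (g w) * h w ^ m * (w - z) ^ m" for w
      unfolding R(2)[symmetric] by (subst K(1)) (simp add: gh power_mult_distrib)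
  qed (use nz F g h in \<open>auto intro!: holomorphic_intros\<close>)
qed

section \<open>Fibres and multiplicities of S on the whole sphere\<close>

lemma rat_map_Fin: "rat_map S (Fin u) = proj_point (poly (rat_num S) u) (poly (rat_den S) u)"
  by (simp add: rat_map_def proj_point_def)

text \<open>At w = 0 the reversed polynomials take the coefficients of u^n in P and Q as values. The
  one of Q is zero exactly when Q has smaller degree than P, which is the case split of
  \<open>rat_map\<close> at \<open>Infty\<close>.\<close>

lemma rat_map_recip:
  "rat_map S (recip (Fin w)) =
     proj_point (poly (rev_poly (rat_degree S) (rat_num S)) w) (poly (rev_poly (rat_degree S) (rat_den S)) w)"
proof (cases "w = 0")
  case True
  show ?thesis
  proof (cases "degree (rat_num S) > degree (rat_den S)")
    case True
    thus ?thesis using \<open>w = 0\<close>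
      by (auto simp: rat_map_def proj_point_def poly_rev_poly rat_degree_def coeff_eq_0)
  next
    case False
    hence "rat_degree S = degree (rat_den S)" by (simp add: rat_degree_def)
    thus ?thesis using \<open>w = 0\<close> False
      by (auto simp: rat_map_def proj_point_def poly_rev_poly)
  qed
next
  case False
  thus ?thesis by (auto simp: rat_map_def proj_point_def poly_rev_poly rat_degree_def)
qed

lemma poly_fiber_poly: "poly (fiber_poly S a) u = fiber_form a (poly (rat_num S) u) (poly (rat_den S) u)"
  by (cases a) (auto simp: fiber_poly_def fiber_form_def)

lemma degree_fiber_poly_le: "degree (fiber_poly S a) \<le> rat_degree S"
  unfolding rat_degree_def fiber_poly_def
  by (cases a) (auto intro!: order_trans[OF degree_diff_le_max] max.mono order_trans[OF degree_smult_le])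

lemma coeff_fiber_poly: "coeff (fiber_poly S a) i = fiber_form a (coeff (rat_num S) i) (coeff (rat_den S) i)"
  by (cases a) (auto simp: fiber_poly_def fiber_form_def)

lemma poly_rev_fiber_poly:
  "poly (rev_poly (rat_degree S) (fiber_poly S a)) w =
     fiber_form a (poly (rev_poly (rat_degree S) (rat_num S)) w) (poly (rev_poly (rat_degree S) (rat_den S)) w)"
proof -
  have "degree (rat_num S) \<le> rat_degree S" "degree (rat_den S) \<le> rat_degree S"
    by (auto simp: rat_degree_def)
  thus ?thesis
    using degree_fiber_poly_le[of S a]
    by (cases a) (auto simp: poly_rev_poly coeff_fiber_poly poly_fiber_poly fiber_form_def algebra_simps)
qed

text \<open>If P = c Q, then Q divides both coprime polynomials, so it is a unit and S is
  constant.\<close>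

lemma fiber_poly_nz:
  assumes "rat_degree S \<ge> 1"
  shows "fiber_poly S a \<noteq> 0"
proof (cases a)
  case (Fin c)
  show ?thesis
  proof
    assume "fiber_poly S a = 0"
    hence eq: "rat_num S = smult c (rat_den S)" by (simp add: fiber_poly_def Fin)
    hence "rat_den S dvd rat_num S" by (simp add: dvd_smult)
    hence "is_unit (rat_den S)" using coprime_rat[of S] by (metis coprime_common_divisor dvd_refl)
    hence "degree (rat_den S) = 0" by (simp add: is_unit_iff_degree)
    hence "rat_degree S = 0" using eq degree_smult_le[of c "rat_den S"] by (simp add: rat_degree_def)
    thus False using assms by simp
  qed
qed (simp add: fiber_poly_def)

lemma rat_nz: "poly (rat_num S) u \<noteq> 0 \<or> poly (rat_den S) u \<noteq> 0"
  by (rule coprime_poly_0[OF coprime_rat])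

lemma rat_map_eq_iff: "rat_map S (Fin u) = a \<longleftrightarrow> poly (fiber_poly S a) u = 0"
  unfolding rat_map_Fin poly_fiber_poly by (rule proj_point_eq_iff[OF rat_nz])

lemma rev_rat_nz:
  "poly (rev_poly (rat_degree S) (rat_num S)) 0 \<noteq> 0 \<or> poly (rev_poly (rat_degree S) (rat_den S)) 0 \<noteq> 0"
proof (cases "degree (rat_num S) > degree (rat_den S)")
  case True
  hence "rat_num S \<noteq> 0" by auto
  thus ?thesis using True by (auto simp: poly_rev_poly rat_degree_def)
next
  case False
  thus ?thesis by (auto simp: poly_rev_poly rat_degree_def max_def)
qed

lemma rat_map_Infty_eq_iff:
  assumes "rat_degree S \<ge> 1"
  shows "rat_map S Infty = a \<longleftrightarrow> degree (fiber_poly S a) < rat_degree S"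
proof -
  have "rat_map S Infty = a \<longleftrightarrow> poly (rev_poly (rat_degree S) (fiber_poly S a)) 0 = 0"
    using rat_map_recip[of S 0] proj_point_eq_iff[OF rev_rat_nz, of S a] by (simp add: poly_rev_fiber_poly)
  also have "\<dots> \<longleftrightarrow> coeff (fiber_poly S a) (rat_degree S) = 0"
    by (simp add: poly_rev_poly degree_fiber_poly_le)
  also have "\<dots> \<longleftrightarrow> degree (fiber_poly S a) < rat_degree S"
    using degree_fiber_poly_le[of S a] fiber_poly_nz[OF assms, of a]
    by (metis coeff_eq_0 le_neq_implies_less leading_coeff_0_iff)
  finally show ?thesis .
qed

lemma e_mult_Fin:
  assumes "rat_degree S \<ge> 1"
  shows "e_mult S (Fin u) = order u (fiber_poly S (rat_map S (Fin u)))"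
  unfolding e_mult_def local_degree_def csphere.case
  by (rule local_mult_proj_point_compose[where g = "\<lambda>w. w" and p = "rat_num S" and q = "rat_den S"])
     (use fiber_poly_nz[OF assms] rat_nz[of S u] in \<open>auto simp: rat_map_Fin poly_fiber_poly\<close>)

lemma e_mult_Infty:
  assumes "rat_degree S \<ge> 1"
  shows "e_mult S Infty = rat_degree S - degree (fiber_poly S (rat_map S Infty))"
proof -
  have "e_mult S Infty = order 0 (rev_poly (rat_degree S) (fiber_poly S (rat_map S (recip (Fin 0)))))"
    unfolding e_mult_def local_degree_def csphere.case
    by (rule local_mult_proj_point_compose[where g = "\<lambda>w. w" and
           p = "rev_poly (rat_degree S) (rat_num S)" and q = "rev_poly (rat_degree S) (rat_den S)"])
       (simp_all only: rat_map_recip poly_rev_fiber_poly rev_rat_nz rev_poly_nz[OF fiber_poly_nz[OF assms]]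
          deriv_ident holomorphic_on_ident not_False_eq_True one_neq_zero)
  also have "\<dots> = rat_degree S - degree (fiber_poly S (rat_map S Infty))"
    using fiber_poly_nz[OF assms] by (simp add: order_rev_poly)
  finally show ?thesis .
qed

text \<open>Off the fibre both sides are 0, a non-root having order 0, so the case distinction in
  \<open>eps\<close> disappears. At infinity the same holds, full degree n meaning multiplicity
  0.\<close>

lemma eps_Fin:
  assumes "rat_degree S \<ge> 1"
  shows "eps S (Fin u) a = order u (fiber_poly S a)"
  using rat_map_eq_iff[of S u a] fiber_poly_nz[OF assms, of a]
  by (auto simp: eps_def e_mult_Fin[OF assms] order_root intro!: sym[OF order_0I])

lemma eps_Infty:
  assumes "rat_degree S \<ge> 1"
  shows "eps S Infty a = rat_degree S - degree (fiber_poly S a)"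
  using rat_map_Infty_eq_iff[OF assms, of a]
  by (auto simp: eps_def e_mult_Infty[OF assms])

lemma local_mult_rat_exp:
  assumes "rat_degree S \<ge> 1" "q \<ge> 1"
  defines "f \<equiv> (\<lambda>z. rat_map S (Fin (exp (z / of_nat q))))"
  shows "local_mult f z = order (exp (z / of_nat q)) (fiber_poly S (f z))"
proof (rule local_mult_proj_point_compose[where g = "\<lambda>z. exp (z / of_nat q)" and p = "rat_num S" and q = "rat_den S"])
  have "((\<lambda>z. exp (z / of_nat q)) has_field_derivative exp (z / of_nat q) / of_nat q) (at z)"
    using assms(2) by (auto intro!: derivative_eq_intros)
  hence "deriv (\<lambda>z. exp (z / of_nat q)) z = exp (z / of_nat q) / of_nat q" by (rule DERIV_imp_deriv)
  thus "deriv (\<lambda>z. exp (z / of_nat q)) z \<noteq> 0" using assms by simp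
  show "(\<lambda>z::complex. exp (z / of_nat q)) holomorphic_on UNIV"
    using assms by (intro holomorphic_intros) auto
qed (use fiber_poly_nz[OF assms(1)] rat_nz in \<open>auto simp: f_def rat_map_Fin poly_fiber_poly\<close>)

lemma sum_order_eq_degree:
  fixes p :: "complex poly"
  assumes "p \<noteq> 0"
  shows "(\<Sum>z | poly p z = 0. order z p) = degree p"
proof -
  have "degree p = degree (smult (lead_coeff p) (\<Prod>z|poly p z = 0. [:-z, 1:] ^ order z p))"
    by (simp only: complex_poly_decompose)
  also have "\<dots> = (\<Sum>z | poly p z = 0. order z p)"
    using assms by (simp add: degree_prod_sum_eq degree_power_eq)
  finally show ?thesis by simp
qed

lemma sum_order_nonzero_roots:
  fixes p :: "complex poly"
  assumes "p \<noteq> 0"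
  shows "(\<Sum>z | z \<noteq> 0 \<and> poly p z = 0. order z p) + order 0 p = degree p"
proof -
  have fin: "finite {z. poly p z = 0}" by (rule poly_roots_finite[OF assms])
  show ?thesis
  proof (cases "poly p 0 = 0")
    case True
    have "{z. poly p z = 0} = insert 0 {z. z \<noteq> 0 \<and> poly p z = 0}" using True by auto
    hence "degree p = sum (\<lambda>z. order z p) (insert 0 {z. z \<noteq> 0 \<and> poly p z = 0})"
      using sum_order_eq_degree[OF assms] by simp
    also have "\<dots> = order 0 p + (\<Sum>z | z \<noteq> 0 \<and> poly p z = 0. order z p)"
      using fin by (subst sum.insert) auto
    finally show ?thesis by simp
  next
    case False
    hence "{z. z \<noteq> 0 \<and> poly p z = 0} = {z. poly p z = 0}" by auto
    thus ?thesis using sum_order_eq_degree[OF assms] order_0I[OF False] by simp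
  qed
qed

text \<open>A fibre of S has n points on the sphere, counted with multiplicity; those at 0 and
  infinity are lost, being the values that the exponential omits.\<close>

lemma sum_order_fiber_poly:
  assumes "rat_degree S \<ge> 1"
  shows "real (\<Sum>z | z \<noteq> 0 \<and> poly (fiber_poly S a) z = 0. order z (fiber_poly S a)) =
     real (rat_degree S) - real (eps S (Fin 0) a) - real (eps S Infty a)"
proof -
  define T where "T = (\<Sum>z | z \<noteq> 0 \<and> poly (fiber_poly S a) z = 0. order z (fiber_poly S a))"
  have "T + order 0 (fiber_poly S a) = degree (fiber_poly S a)"
    unfolding T_def by (rule sum_order_nonzero_roots[OF fiber_poly_nz[OF assms]])
  thus ?thesis using degree_fiber_poly_le[of S a]
    unfolding T_def[symmetric] eps_Fin[OF assms] eps_Infty[OF assms] by linarith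
qed

section \<open>Counting the points of a fibre\<close>

text \<open>For t >= 0 these are the integers in an interval of length t / pi. The lower bound also
  covers negative t, as it is applied with s / q - |Re L|.\<close>

lemma card_int_abs_le:
  fixes y t :: real
  shows "finite {k::int. \<bar>y + 2 * pi * of_int k\<bar> \<le> t}"
    and "t / pi - 1 \<le> card {k::int. \<bar>y + 2 * pi * of_int k\<bar> \<le> t}"
    and "0 \<le> t \<Longrightarrow> card {k::int. \<bar>y + 2 * pi * of_int k\<bar> \<le> t} \<le> t / pi + 1"
proof -
  define u v where "u = (- t - y) / (2 * pi)" and "v = (t - y) / (2 * pi)"
  have eq: "{k::int. \<bar>y + 2 * pi * of_int k\<bar> \<le> t} = {\<lceil>u\<rceil>..\<lfloor>v\<rfloor>}"
    by (auto simp: u_def v_def ceiling_le_iff le_floor_iff field_simps abs_le_iff)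
  have uv: "v - u = t / pi" by (simp add: u_def v_def field_simps)
  show "finite {k::int. \<bar>y + 2 * pi * of_int k\<bar> \<le> t}" by (simp add: eq)
  have fl: "of_int \<lfloor>v\<rfloor> \<le> v" "v < of_int \<lfloor>v\<rfloor> + 1" "u \<le> of_int \<lceil>u\<rceil>" "of_int \<lceil>u\<rceil> < u + 1"
    by linarith+
  show "t / pi - 1 \<le> card {k::int. \<bar>y + 2 * pi * of_int k\<bar> \<le> t}"
    unfolding eq card_atLeastAtMost_int using fl uv by linarith
  show "card {k::int. \<bar>y + 2 * pi * of_int k\<bar> \<le> t} \<le> t / pi + 1" if "0 \<le> t"
  proof -
    have "t / pi \<ge> 0" using that by simp
    thus ?thesis unfolding eq card_atLeastAtMost_int using fl uv by linarith
  qed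
qed

text \<open>The points are q (Ln \<alpha> + 2 pi i k). As |Im| <= norm <= |Re| + |Im|, their number
  is caught between the counts for two conditions on the imaginary part alone, with thresholds s / q
  - |Re L| and s / q.\<close>

lemma card_exp_fiber:
  fixes \<alpha> :: complex and q :: nat
  assumes "\<alpha> \<noteq> 0" "q \<ge> 1"
  shows "\<exists>C. \<forall>s\<ge>0. finite {z. norm z \<le> s \<and> exp (z / of_nat q) = \<alpha>} \<and>
     \<bar>real (card {z. norm z \<le> s \<and> exp (z / of_nat q) = \<alpha>}) - s / (pi * real q)\<bar> \<le> C"
proof (intro exI allI impI)
  fix s :: real assume s: "s \<ge> 0"
  define L where "L = Ln \<alpha>"
  define \<tau> where "\<tau> = (\<lambda>k::int. of_nat q * (L + of_real (of_int (2 * k) * pi) * \<i>))"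
  define K where "K = {k::int. norm (\<tau> k) \<le> s}"
  define K1 where "K1 = {k::int. \<bar>Im L + 2 * pi * of_int k\<bar> \<le> s / q}"
  define K2 where "K2 = {k::int. \<bar>Im L + 2 * pi * of_int k\<bar> \<le> s / q - \<bar>Re L\<bar>}"
  have q: "real q > 0" using assms by simp
  have inj: "inj \<tau>"
    using assms by (auto simp: inj_def \<tau>_def)
  have eq: "{z. norm z \<le> s \<and> exp (z / of_nat q) = \<alpha>} = \<tau> ` K"
  proof (intro equalityI subsetI)
    fix z assume "z \<in> {z. norm z \<le> s \<and> exp (z / of_nat q) = \<alpha>}"
    hence z: "norm z \<le> s" "exp (z / of_nat q) = exp L" using assms by (auto simp: L_def)
    then obtain k :: int where "z / of_nat q = L + of_real (of_int (2 * k) * pi) * \<i>"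
      unfolding exp_eq by blast
    hence "z = \<tau> k" using assms unfolding \<tau>_def by (metis nonzero_mult_div_cancel_left of_nat_eq_0_iff not_one_le_zero times_divide_eq_right)
    thus "z \<in> \<tau> ` K" using z by (auto simp: K_def)
  next
    fix z assume "z \<in> \<tau> ` K"
    then obtain k where k: "z = \<tau> k" "norm (\<tau> k) \<le> s" by (auto simp: K_def)
    have "exp (\<tau> k / of_nat q) = exp L"
      unfolding exp_eq using assms by (auto simp: \<tau>_def)
    thus "z \<in> {z. norm z \<le> s \<and> exp (z / of_nat q) = \<alpha>}"
      using k assms by (auto simp: L_def)
  qed
  have card: "card (\<tau> ` K) = card K" using inj by (simp add: card_image inj_on_subset)
  have norm_\<tau>: "norm (\<tau> k) = q * norm (L + of_real (of_int (2 * k) * pi) * \<i>)" for k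
    by (simp add: \<tau>_def norm_mult)
  have sub1: "K \<subseteq> K1"
  proof
    fix k assume "k \<in> K"
    hence "norm (L + of_real (of_int (2 * k) * pi) * \<i>) \<le> s / q"
      using q by (simp add: K_def norm_\<tau> field_simps)
    hence "\<bar>Im (L + of_real (of_int (2 * k) * pi) * \<i>)\<bar> \<le> s / q"
      using abs_Im_le_cmod order_trans by blast
    thus "k \<in> K1" by (simp add: K1_def mult_ac)
  qed
  have sub2: "K2 \<subseteq> K"
  proof
    fix k assume "k \<in> K2"
    hence "\<bar>Re (L + of_real (of_int (2 * k) * pi) * \<i>)\<bar> + \<bar>Im (L + of_real (of_int (2 * k) * pi) * \<i>)\<bar> \<le> s / q"
      by (simp add: K2_def mult_ac)
    hence "norm (L + of_real (of_int (2 * k) * pi) * \<i>) \<le> s / q"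
      using cmod_le order_trans by blast
    thus "k \<in> K" using q by (simp add: K_def norm_\<tau> field_simps)
  qed
  have finK: "finite K" using sub1 card_int_abs_le(1)[of "Im L" "s / q"] unfolding K1_def by (rule finite_subset)
  have "real (card K) \<le> card K1"
    using sub1 card_int_abs_le(1)[of "Im L" "s / q"] by (auto simp: K1_def intro!: card_mono)
  also have "\<dots> \<le> s / q / pi + 1"
    unfolding K1_def using s by (intro card_int_abs_le(3)) auto
  finally have up: "real (card K) \<le> s / (pi * q) + 1" by (simp add: mult.commute)
  have "(s / q - \<bar>Re L\<bar>) / pi - 1 \<le> card K2"
    unfolding K2_def by (rule card_int_abs_le(2))
  also have "real (card K2) \<le> card K" using sub2 finK by (auto intro!: card_mono)
  finally have "s / (pi * q) - \<bar>Re L\<bar> / pi - 1 \<le> card K"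
    by (simp add: diff_divide_distrib mult.commute)
  moreover have "\<bar>Re L\<bar> / pi \<ge> 0" by simp
  ultimately have "\<bar>real (card K) - s / (pi * q)\<bar> \<le> 1 + \<bar>Re L\<bar> / pi" using up by linarith
  with eq card finK show "finite {z. norm z \<le> s \<and> exp (z / of_nat q) = \<alpha>} \<and>
     \<bar>real (card {z. norm z \<le> s \<and> exp (z / of_nat q) = \<alpha>}) - s / (pi * real q)\<bar> \<le> 1 + \<bar>Re (Ln \<alpha>)\<bar> / pi"
    by (simp add: L_def)
qed

text \<open>The weight depends on exp (z / q) only, so it is constant on each progression. Taking it
  to be the root order gives N, taking it to be 1 gives the truncated version.\<close>

lemma integrated_weighted_count:
  fixes q :: nat and S :: "complex poly fract" and m :: "complex \<Rightarrow> nat"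
    and a :: csphere
  assumes "q \<ge> 1" "rat_degree S \<ge> 1"
  defines "f \<equiv> (\<lambda>z. rat_map S (Fin (exp (z / of_nat q))))"
  defines "Z \<equiv> {z. z \<noteq> 0 \<and> poly (fiber_poly S a) z = 0}"
  shows "(\<lambda>r. integrated (\<lambda>s. \<Sum>z\<in>apoints f a s. m (exp (z / of_nat q))) r
            - real (\<Sum>\<alpha>\<in>Z. m \<alpha>) / (pi * real q) * r) \<in> O[at_top](\<lambda>r. ln r)"
proof -
  define A where "A = (\<lambda>s \<alpha>. {z::complex. norm z \<le> s \<and> exp (z / of_nat q) = \<alpha>})"
  define N where "N = (\<lambda>s. \<Sum>z\<in>apoints f a s. m (exp (z / of_nat q)))"
  have finZ: "finite Z"
    by (rule finite_subset[OF _ poly_roots_finite[OF fiber_poly_nz[OF assms(2), of a]]]) (auto simp: Z_def)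
  have "\<exists>C :: complex \<Rightarrow> real. \<forall>\<alpha>\<in>Z. \<forall>s\<ge>0. finite (A s \<alpha>) \<and> \<bar>real (card (A s \<alpha>)) - s / (pi * real q)\<bar> \<le> C \<alpha>"
    unfolding A_def by (rule bchoice) (use card_exp_fiber[OF _ assms(1)] in \<open>auto simp: Z_def\<close>)
  then obtain C where C: "\<And>\<alpha> s. \<alpha> \<in> Z \<Longrightarrow> s \<ge> 0 \<Longrightarrow> finite (A s \<alpha>)"
    "\<And>\<alpha> s. \<alpha> \<in> Z \<Longrightarrow> s \<ge> 0 \<Longrightarrow> \<bar>real (card (A s \<alpha>)) - s / (pi * real q)\<bar> \<le> C \<alpha>" by blast
  have ap: "apoints f a s = (\<Union>\<alpha>\<in>Z. A s \<alpha>)" for s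
    by (auto simp: apoints_def f_def rat_map_eq_iff A_def Z_def)
  have fin: "finite (apoints f a s)" if "s \<ge> 0" for s
    unfolding ap using finZ C(1) that by blast
  have N: "N s = (\<Sum>\<alpha>\<in>Z. m \<alpha> * card (A s \<alpha>))" if "s \<ge> 0" for s
  proof -
    have "N s = (\<Sum>\<alpha>\<in>Z. \<Sum>z\<in>A s \<alpha>. m (exp (z / of_nat q)))"
      unfolding N_def ap using finZ C(1) that by (intro sum.UNION_disjoint) (auto simp: A_def)
    also have "\<dots> = (\<Sum>\<alpha>\<in>Z. \<Sum>z\<in>A s \<alpha>. m \<alpha>)"
      by (intro sum.cong) (auto simp: A_def)
    finally show ?thesis by (simp add: mult.commute)
  qed
  \<comment> \<open>Nonzero a-points in the unit disc keep the distance d from the origin, so the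
    count is constant on a short initial interval, as \<open>integrated_asymp\<close>
    requires.\<close>
  obtain d where d: "d > 0" "\<And>z. z \<in> apoints f a 1 \<Longrightarrow> z \<noteq> 0 \<Longrightarrow> d \<le> dist 0 z"
    using finite_set_avoid[OF fin[of 1], of 0] by auto
  have "(\<lambda>r. integrated N r - real (\<Sum>\<alpha>\<in>Z. m \<alpha>) / (pi * real q) * r) \<in> O[at_top](\<lambda>r. ln r)"
  proof (rule integrated_asymp)
    show "N s \<le> N t" if "0 \<le> s" "s \<le> t" for s t
      unfolding N_def using that fin[of t] by (intro sum_mono2) (auto simp: apoints_def)
    show "\<bar>real (N s) - real (\<Sum>\<alpha>\<in>Z. m \<alpha>) / (pi * real q) * s\<bar> \<le> (\<Sum>\<alpha>\<in>Z. real (m \<alpha>) * C \<alpha>)" if "0 \<le> s" for s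
    proof -
      have "real (N s) - real (\<Sum>\<alpha>\<in>Z. m \<alpha>) / (pi * real q) * s =
          (\<Sum>\<alpha>\<in>Z. real (m \<alpha>) * (real (card (A s \<alpha>)) - s / (pi * real q)))"
        by (simp add: N[OF that] right_diff_distrib sum_subtractf sum_divide_distrib sum_distrib_right)
      also have "\<bar>\<dots>\<bar> \<le> (\<Sum>\<alpha>\<in>Z. real (m \<alpha>) * C \<alpha>)"
        by (rule order_trans[OF sum_abs], rule sum_mono)
           (use C(2) that in \<open>auto simp: abs_mult intro!: mult_left_mono\<close>)
      finally show ?thesis .
    qed
    show "0 < min 1 (d / 2)" using d by simp
    show "N s = N 0" if "0 \<le> s" "s \<le> min 1 (d / 2)" for s
    proof -
      have "apoints f a s = apoints f a 0"
      proof (intro equalityI subsetI)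
        fix z assume z: "z \<in> apoints f a s"
        hence "z \<in> apoints f a 1" using that by (auto simp: apoints_def)
        with d(2)[of z] z that d(1) have "z = 0" by (auto simp: apoints_def)
        thus "z \<in> apoints f a 0" using z by (auto simp: apoints_def)
      qed (use that in \<open>auto simp: apoints_def\<close>)
      thus ?thesis by (simp add: N_def)
    qed
  qed
  thus ?thesis by (simp only: N_def)
qed

section \<open>Asymptotics of the Nevanlinna functions of f\<close>

lemma nev_N_asymp:
  fixes q :: nat and S :: "complex poly fract"
  assumes "q \<ge> 1" "rat_degree S \<ge> 1"
  defines "f \<equiv> (\<lambda>z. rat_map S (Fin (exp (z / of_nat q))))"
  shows "(\<lambda>r. nev_N r a f - (real (rat_degree S) - real (eps S (Fin 0) a) - real (eps S Infty a)) / (pi * real q) * r)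
            \<in> O[at_top](\<lambda>r. ln r)"
proof -
  have "count_mult f a = (\<lambda>s. \<Sum>z\<in>apoints f a s. order (exp (z / of_nat q)) (fiber_poly S a))"
    unfolding count_mult_def f_def
    by (intro ext sum.cong refl) (auto simp: local_mult_rat_exp[OF assms(2,1)] apoints_def)
  thus ?thesis
    using integrated_weighted_count[OF assms(1,2), where a = a and m = "\<lambda>\<alpha>. order \<alpha> (fiber_poly S a)"]
    unfolding nev_N_def sum_order_fiber_poly[OF assms(2)] f_def by simp
qed

lemma nu_eq: "nu S a = card {z. z \<noteq> 0 \<and> poly (fiber_poly S a) z = 0}"
  by (simp add: nu_def rat_map_eq_iff)

lemma nev_Nbar_asymp:
  fixes q :: nat and S :: "complex poly fract"
  assumes "q \<ge> 1" "rat_degree S \<ge> 1"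
  defines "f \<equiv> (\<lambda>z. rat_map S (Fin (exp (z / of_nat q))))"
  shows "(\<lambda>r. nev_Nbar r a f - real (nu S a) / (pi * real q) * r) \<in> O[at_top](\<lambda>r. ln r)"
proof -
  have "count_trunc f a = (\<lambda>s. \<Sum>z\<in>apoints f a s. 1)"
    by (simp add: count_trunc_def fun_eq_iff)
  thus ?thesis
    using integrated_weighted_count[OF assms(1,2), where a = a and m = "\<lambda>_. 1"]
    unfolding nev_Nbar_def nu_eq f_def by simp
qed

lemma nev_T_asymp:
  fixes q :: nat and S :: "complex poly fract"
  assumes "q \<ge> 1" "rat_degree S \<ge> 1"
  defines "f \<equiv> (\<lambda>z. rat_map S (Fin (exp (z / of_nat q))))"
  shows "(\<lambda>r. nev_T r f - real (rat_degree S) / (pi * real q) * r) \<in> O[at_top](\<lambda>r. ln r)"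
proof -
  define M where "M = (\<Sum>z | z \<noteq> 0 \<and> poly (rat_den S) z = 0. order z (rat_den S))"
  \<comment> \<open>The fibre polynomial over \<open>Infty\<close> is Q, so M is both the term
    subtracted in the proximity function and the coefficient of the counting function of
    poles.\<close>
  have M: "real M = real (rat_degree S) - real (eps S (Fin 0) Infty) - real (eps S Infty Infty)"
    using sum_order_fiber_poly[OF assms(2), of Infty] by (simp add: M_def fiber_poly_def)
  obtain C where C: "\<forall>\<^sub>F r in at_top. \<bar>nev_m r f - (real (rat_degree S) - real M) / (pi * real q) * r\<bar> \<le> C"
    using nev_m_asymp[OF assms(1) refl, of S] unfolding f_def M_def by blast
  have "(\<lambda>r. nev_m r f - (real (rat_degree S) - real M) / (pi * real q) * r) \<in> O[at_top](\<lambda>r. ln r)"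
    by (rule bigo_lnI[of _ C 0]) (use C in simp)
  from sum_in_bigo(1)[OF this nev_N_asymp[OF assms(1,2), of Infty]]
  show ?thesis
    unfolding M[symmetric] f_def[symmetric] nev_T_def
    by (simp add: diff_divide_distrib left_diff_distrib algebra_simps)
qed

lemma tendsto_ratio_linear:
  fixes F G :: "real \<Rightarrow> real"
  assumes F: "(\<lambda>r. F r - c * r) \<in> O[at_top](\<lambda>r. ln r)" and G: "(\<lambda>r. G r - d * r) \<in> O[at_top](\<lambda>r. ln r)"
    and d: "d \<noteq> 0"
  shows "((\<lambda>r. F r / G r) \<longlongrightarrow> c / d) at_top"
proof -
  have *: "((\<lambda>r. H r / r) \<longlongrightarrow> e) at_top" if "(\<lambda>r. H r - e * r) \<in> O[at_top](\<lambda>r. ln r)" for H :: "real \<Rightarrow> real" and e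
  proof -
    have "(\<lambda>r::real. ln r) \<in> o[at_top](\<lambda>r. r)" by real_asymp
    with that have "(\<lambda>r. H r - e * r) \<in> o[at_top](\<lambda>r. r)" by (rule landau_o.big_small_trans)
    hence "((\<lambda>r. (H r - e * r) / r) \<longlongrightarrow> 0) at_top" by (rule smalloD_tendsto)
    hence "((\<lambda>r. (H r - e * r) / r + e) \<longlongrightarrow> 0 + e) at_top" by (intro tendsto_intros)
    moreover have "\<forall>\<^sub>F r in at_top. (H r - e * r) / r + e = H r / r"
      using eventually_gt_at_top[of 0] by eventually_elim (simp add: field_simps)
    ultimately show ?thesis by (simp add: Lim_transform_eventually)
  qed
  have "((\<lambda>r. (F r / r) / (G r / r)) \<longlongrightarrow> c / d) at_top"
    by (intro tendsto_divide * F G d)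
  moreover have "\<forall>\<^sub>F r in at_top. (F r / r) / (G r / r) = F r / G r"
    using eventually_gt_at_top[of 0] by eventually_elim simp
  ultimately show ?thesis by (rule Lim_transform_eventually)
qed

section \<open>The Riemann-Hurwitz formula\<close>

text \<open>The numerator of the derivative of R / T over T^2. Being antisymmetric in R and T, it
  treats zeros and poles alike and so detects ramification at poles too.\<close>

definition wronskian :: "complex poly \<Rightarrow> complex poly \<Rightarrow> complex poly" where
  "wronskian R T = pderiv R * T - R * pderiv T"

text \<open>Differentiation lowers the order k + 1 of the root by one, and the cofactor of X^k takes
  the value (k + 1) K T at \<alpha>, nonzero in characteristic 0. The term with T' keeps a further
  factor X.\<close>

lemma order_wronskian:
  assumes "R \<noteq> 0" "poly R \<alpha> = 0" "poly T \<alpha> \<noteq> 0"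
  shows "order \<alpha> R = Suc (order \<alpha> (wronskian R T))"
proof -
  obtain k where k: "order \<alpha> R = Suc k"
    using assms order_root[of R \<alpha>] by (cases "order \<alpha> R") auto
  define X where "X = [:-\<alpha>, 1:]"
  obtain K where K: "R = X ^ Suc k * K" "\<not> X dvd K"
    using order_decomp[OF assms(1), of \<alpha>] unfolding k X_def by blast
  have "pderiv R = X ^ k * (smult (of_nat (Suc k)) K + X * pderiv K)"
    by (subst K(1), unfold pderiv_mult pderiv_power_Suc)
       (simp add: X_def pderiv_pCons algebra_simps)
  hence W: "wronskian R T = X ^ k * ((smult (of_nat (Suc k)) K + X * pderiv K) * T - X * K * pderiv T)"
    (is "_ = _ * ?B") unfolding wronskian_def by (simp add: K(1) algebra_simps)
  have "poly K \<alpha> \<noteq> 0" using K(2) by (simp add: X_def poly_eq_0_iff_dvd)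
  hence B: "poly ?B \<alpha> \<noteq> 0" using assms by (simp add: X_def del: of_nat_Suc)
  hence "?B \<noteq> 0" by (metis poly_0)
  hence "order \<alpha> (wronskian R T) = order \<alpha> (X ^ k) + order \<alpha> ?B"
    unfolding W by (intro order_mult) (auto simp: X_def)
  also have "order \<alpha> (X ^ k) = k" unfolding X_def by (rule order_power_n_n)
  also have "order \<alpha> ?B = 0" using B by (rule order_0I)
  finally show ?thesis using k by simp
qed

text \<open>The coefficient in degree d + n - 1 is d - n times the two leading coefficients, and
  unequal degrees keep it from cancelling.\<close>

lemma degree_wronskian:
  assumes "R \<noteq> 0" "degree R < degree T"
  shows "degree (wronskian R T) = degree R + degree T - 1" "wronskian R T \<noteq> 0"
proof -
  define d n where "d = degree R" and "n = degree T"
  have n: "d < n" using assms by (simp add: d_def n_def)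
  have 1: "coeff (pderiv R * T) (d + n - 1) = of_nat d * lead_coeff R * lead_coeff T"
  \<comment> \<open>For d = 0 truncated subtraction would make the degrees of R' and T add up to n
    instead of d + n - 1; but then R' = 0.\<close>
  proof (cases "d = 0")
    case True
    hence "pderiv R = 0" by (simp add: d_def pderiv_eq_0_iff)
    thus ?thesis using True by simp
  next
    case False
    have dp: "degree (pderiv R) = d - 1" by (simp add: d_def degree_pderiv)
    have "d + n - 1 = degree (pderiv R) + degree T" using False by (simp add: dp n_def)
    hence "coeff (pderiv R * T) (d + n - 1) = lead_coeff (pderiv R) * lead_coeff T"
      by (simp only: coeff_mult_degree_sum)
    also have "lead_coeff (pderiv R) = of_nat d * lead_coeff R"
      unfolding dp coeff_pderiv using False by (simp add: d_def)
    finally show ?thesis .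
  qed
  have 2: "coeff (R * pderiv T) (d + n - 1) = of_nat n * lead_coeff R * lead_coeff T"
  proof -
    have dp: "degree (pderiv T) = n - 1" by (simp add: n_def degree_pderiv)
    have "d + n - 1 = degree R + degree (pderiv T)" using n by (simp add: dp d_def)
    hence "coeff (R * pderiv T) (d + n - 1) = lead_coeff R * lead_coeff (pderiv T)"
      by (simp only: coeff_mult_degree_sum)
    also have "lead_coeff (pderiv T) = of_nat n * lead_coeff T"
      unfolding dp coeff_pderiv using n by (simp add: n_def)
    finally show ?thesis by simp
  qed
  have "T \<noteq> 0" using n by (auto simp: n_def)
  moreover have "coeff (wronskian R T) (d + n - 1) = (of_nat d - of_nat n) * lead_coeff R * lead_coeff T"
    unfolding wronskian_def coeff_diff 1 2 by (simp add: algebra_simps)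
  ultimately have nz: "coeff (wronskian R T) (d + n - 1) \<noteq> 0"
    using assms n by simp
  thus "wronskian R T \<noteq> 0" by auto
  have "degree (pderiv R * T) \<le> d + n - 1"
  proof (cases "d = 0")
    case True
    hence "pderiv R = 0" by (simp add: d_def pderiv_eq_0_iff)
    thus ?thesis by simp
  next
    case False
    thus ?thesis using degree_mult_le[of "pderiv R" T] by (simp add: degree_pderiv d_def n_def)
  qed
  moreover have "degree (R * pderiv T) \<le> d + n - 1"
    using degree_mult_le[of R "pderiv T"] n by (simp add: degree_pderiv d_def n_def)
  ultimately have "degree (wronskian R T) \<le> d + n - 1"
    unfolding wronskian_def by (rule degree_diff_le)
  with le_degree[OF nz] show "degree (wronskian R T) = degree R + degree T - 1"
    by (simp add: d_def n_def)
qed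

text \<open>
  Up to sign, the Wronskian of \<open>P\<close> and \<open>Q\<close> does not change when \<open>(P, Q)\<close> is replaced by the equation of
  a fibre together with a second member of the pencil.
\<close>

lemma fiber_poly_partner:
  obtains T where
    "\<And>u. poly (fiber_poly S a) u = 0 \<Longrightarrow> poly T u \<noteq> 0"
    "degree (fiber_poly S a) < rat_degree S \<Longrightarrow> degree T = rat_degree S"
    "wronskian (fiber_poly S a) T = wronskian (rat_num S) (rat_den S) \<or>
     wronskian (fiber_poly S a) T = - wronskian (rat_num S) (rat_den S)"
proof (cases a)
  case (Fin c)
  show ?thesis
  proof (rule that[of "rat_den S"])
    show "poly (rat_den S) u \<noteq> 0" if "poly (fiber_poly S a) u = 0" for u
      using that rat_nz[of S u] by (auto simp: Fin fiber_poly_def)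
    show "degree (rat_den S) = rat_degree S" if less: "degree (fiber_poly S a) < rat_degree S"
    proof (rule ccontr)
      assume "degree (rat_den S) \<noteq> rat_degree S"
      hence den: "degree (rat_den S) < rat_degree S" "degree (rat_num S) = rat_degree S"
        by (auto simp: rat_degree_def max_def split: if_splits)
      have "degree (fiber_poly S a + smult c (rat_den S)) < rat_degree S"
        using less den(1) degree_smult_le[of c "rat_den S"] by (intro degree_add_less) auto
      thus False using den by (simp add: Fin fiber_poly_def)
    qed
  qed (simp add: wronskian_def fiber_poly_def Fin pderiv_diff pderiv_smult algebra_simps)
next
  case Infty
  show ?thesis
  proof (rule that[of "rat_num S"])
    show "poly (rat_num S) u \<noteq> 0" if "poly (fiber_poly S a) u = 0" for u
      using that rat_nz[of S u] by (auto simp: Infty fiber_poly_def)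
    show "degree (rat_num S) = rat_degree S" if "degree (fiber_poly S a) < rat_degree S"
      using that by (auto simp: rat_degree_def Infty fiber_poly_def max_def split: if_splits)
  qed (simp add: wronskian_def fiber_poly_def Infty algebra_simps)
qed

text \<open>The partner polynomial has no root in common with the fibre polynomial. So one Wronskian
  has order e - 1 at every finite point of multiplicity e, whichever value the point lies
  over.\<close>

lemma order_fiber_poly:
  assumes "rat_degree S \<ge> 1" "poly (fiber_poly S a) \<alpha> = 0"
  shows "order \<alpha> (fiber_poly S a) = Suc (order \<alpha> (wronskian (rat_num S) (rat_den S)))"
proof -
  obtain T where T: "\<And>u. poly (fiber_poly S a) u = 0 \<Longrightarrow> poly T u \<noteq> 0"
    "wronskian (fiber_poly S a) T = wronskian (rat_num S) (rat_den S) \<or>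
     wronskian (fiber_poly S a) T = - wronskian (rat_num S) (rat_den S)"
    using fiber_poly_partner[of S a] by metis
  have "order \<alpha> (fiber_poly S a) = Suc (order \<alpha> (wronskian (fiber_poly S a) T))"
    using assms T(1) fiber_poly_nz by (intro order_wronskian) auto
  thus ?thesis using T(2) by (auto simp: order_uminus)
qed

text \<open>P and Q may have equal degree, and then the leading terms of their Wronskian cancel. The
  member over S(Infty) has degree n - e, with e the multiplicity at infinity, and its partner has
  degree n, so the degree 2 n - e - 1 can be read off from this pair.\<close>

lemma degree_rat_wronskian:
  assumes "rat_degree S \<ge> 1"
  shows "degree (wronskian (rat_num S) (rat_den S)) + 1 + e_mult S Infty = 2 * rat_degree S"
    and "wronskian (rat_num S) (rat_den S) \<noteq> 0"
proof -
  define R where "R = fiber_poly S (rat_map S Infty)"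
  have R: "degree R < rat_degree S" "R \<noteq> 0"
    using rat_map_Infty_eq_iff[OF assms] fiber_poly_nz[OF assms] unfolding R_def by auto
  obtain T where T: "degree T = rat_degree S"
    "wronskian R T = wronskian (rat_num S) (rat_den S) \<or> wronskian R T = - wronskian (rat_num S) (rat_den S)"
    using fiber_poly_partner[of S "rat_map S Infty"] R(1) unfolding R_def by metis
  have "degree (wronskian R T) = degree R + degree T - 1" "wronskian R T \<noteq> 0"
    using R T(1) by (intro degree_wronskian; simp)+
  thus "degree (wronskian (rat_num S) (rat_den S)) + 1 + e_mult S Infty = 2 * rat_degree S"
    and "wronskian (rat_num S) (rat_den S) \<noteq> 0"
    using T R unfolding e_mult_Infty[OF assms] R_def[symmetric] by auto
qed

text \<open>Among the n preimages, a nonzero finite point of multiplicity e is counted once by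
  \<open>nu\<close> and e - 1 times by the Wronskian.\<close>

lemma degree_eq_nu_plus:
  assumes "rat_degree S \<ge> 1"
  shows "rat_degree S = nu S a + eps S (Fin 0) a + eps S Infty a +
    (\<Sum>z | z \<noteq> 0 \<and> poly (fiber_poly S a) z = 0. order z (wronskian (rat_num S) (rat_den S)))"
proof -
  let ?Z = "{z. z \<noteq> 0 \<and> poly (fiber_poly S a) z = 0}"
  have "(\<Sum>z\<in>?Z. order z (fiber_poly S a)) =
        (\<Sum>z\<in>?Z. 1 + order z (wronskian (rat_num S) (rat_den S)))"
    by (intro sum.cong) (auto simp: order_fiber_poly[OF assms])
  also have "\<dots> = nu S a + (\<Sum>z\<in>?Z. order z (wronskian (rat_num S) (rat_den S)))"
    by (simp only: sum.distrib nu_eq card_eq_sum)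
  finally have "(\<Sum>z\<in>?Z. order z (fiber_poly S a)) =
     nu S a + (\<Sum>z\<in>?Z. order z (wronskian (rat_num S) (rat_den S)))" .
  with sum_order_fiber_poly[OF assms, of a] show ?thesis by linarith
qed

text \<open>Outside \<open>A\<close>, which holds S(0), S(Infty) and the values at finite
  ramification points, all n preimages are distinct, finite and nonzero. Hence only \<open>A\<close>
  matters for the truncated deficiencies.\<close>

lemma riemann_hurwitz_nu:
  assumes n: "rat_degree S \<ge> 1"
  defines "W \<equiv> wronskian (rat_num S) (rat_den S)"
  defines "A \<equiv> {rat_map S (Fin 0), rat_map S Infty} \<union> (\<lambda>z. rat_map S (Fin z)) ` {z. poly W z = 0}"
  shows "finite A" "\<And>a. a \<notin> A \<Longrightarrow> nu S a = rat_degree S"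
    and "(\<Sum>a\<in>A. real (rat_degree S) - real (nu S a)) = 2 * real (rat_degree S)"
proof -
  define Z where "Z = (\<lambda>a. {z. z \<noteq> 0 \<and> poly (fiber_poly S a) z = 0})"
  have Wnz: "W \<noteq> 0" unfolding W_def by (rule degree_rat_wronskian[OF n])
  show finA: "finite A" unfolding A_def using poly_roots_finite[OF Wnz] by simp
  have finZ: "finite (Z a)" for a
    by (rule finite_subset[OF _ poly_roots_finite[OF fiber_poly_nz[OF n, of a]]]) (auto simp: Z_def)
  have eq: "rat_degree S = nu S a + eps S (Fin 0) a + eps S Infty a + (\<Sum>z\<in>Z a. order z W)" for a
    unfolding Z_def W_def by (rule degree_eq_nu_plus[OF n])
  show "nu S a = rat_degree S" if a: "a \<notin> A" for a
  proof -
    have "order z W = 0" if "z \<in> Z a" for z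
      using that a by (intro order_0I) (auto simp: Z_def A_def rat_map_eq_iff[symmetric])
    moreover have "eps S (Fin 0) a = 0" "eps S Infty a = 0"
      using a by (auto simp: A_def eps_def)
    ultimately show ?thesis using eq[of a] by simp
  qed
  have "(\<Sum>a\<in>A. real (rat_degree S) - real (nu S a)) =
        (\<Sum>a\<in>A. real (eps S (Fin 0) a) + real (eps S Infty a) + real (\<Sum>z\<in>Z a. order z W))"
  proof (intro sum.cong refl)
    show "real (rat_degree S) - real (nu S a) =
      real (eps S (Fin 0) a) + real (eps S Infty a) + real (\<Sum>z\<in>Z a. order z W)" for a
      using eq[of a] by linarith
  qed
  also have "\<dots> = real (\<Sum>a\<in>A. eps S (Fin 0) a) + real (\<Sum>a\<in>A. eps S Infty a) + real (\<Sum>a\<in>A. \<Sum>z\<in>Z a. order z W)"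
    by (simp add: sum.distrib)
  also have "(\<Sum>a\<in>A. eps S (Fin 0) a) = e_mult S (Fin 0)"
    unfolding eps_def using finA by (subst sum.delta') (auto simp: A_def)
  also have "(\<Sum>a\<in>A. eps S Infty a) = e_mult S Infty"
    unfolding eps_def using finA by (subst sum.delta') (auto simp: A_def)
  also have "(\<Sum>a\<in>A. \<Sum>z\<in>Z a. order z W) = (\<Sum>z\<in>(\<Union>a\<in>A. Z a). order z W)"
    using finA finZ by (intro sum.UNION_disjoint[symmetric]) (auto simp: Z_def rat_map_eq_iff[symmetric])
  \<comment> \<open>Every nonzero root of W lies over a value in \<open>A\<close>; the other points
    of the union have order 0.\<close>
  also have "\<dots> = (\<Sum>z | z \<noteq> 0 \<and> poly W z = 0. order z W)"
  proof (rule sum.mono_neutral_right)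
    show "{z. z \<noteq> 0 \<and> poly W z = 0} \<subseteq> (\<Union>a\<in>A. Z a)"
      by (auto simp: A_def Z_def rat_map_eq_iff[symmetric])
    show "\<forall>z\<in>(\<Union>a\<in>A. Z a) - {z. z \<noteq> 0 \<and> poly W z = 0}. order z W = 0"
    proof
      fix z assume "z \<in> (\<Union>a\<in>A. Z a) - {z. z \<noteq> 0 \<and> poly W z = 0}"
      hence "poly W z \<noteq> 0" by (auto simp: Z_def)
      thus "order z W = 0" by (rule order_0I)
    qed
  qed (use finA finZ in auto)
  finally have *: "(\<Sum>a\<in>A. real (rat_degree S) - real (nu S a)) =
     real (e_mult S (Fin 0)) + real (e_mult S Infty) + real (\<Sum>z | z \<noteq> 0 \<and> poly W z = 0. order z W)" .
  \<comment> \<open>With e0, e1 the multiplicities at 0 and infinity, the total is e0 + e1 + (deg W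
    - (e0 - 1)), and deg W = 2 n - 1 - e1 turns it into 2 n.\<close>
  have "(\<Sum>z | z \<noteq> 0 \<and> poly W z = 0. order z W) + order 0 W = degree W"
    by (rule sum_order_nonzero_roots[OF Wnz])
  moreover have "e_mult S (Fin 0) = Suc (order 0 W)"
    unfolding e_mult_Fin[OF n] W_def
    by (rule order_fiber_poly[OF n]) (simp add: rat_map_eq_iff[symmetric])
  moreover have "degree W + 1 + e_mult S Infty = 2 * rat_degree S"
    unfolding W_def by (rule degree_rat_wronskian[OF n])
  ultimately show "(\<Sum>a\<in>A. real (rat_degree S) - real (nu S a)) = 2 * real (rat_degree S)"
    unfolding * by linarith
qed

section \<open>Deficiencies\<close>

lemma deficiency_rat_exp:
  fixes q :: nat and S :: "complex poly fract"
  assumes "q \<ge> 1" and n: "rat_degree S \<ge> 1"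
  defines "f \<equiv> (\<lambda>z. rat_map S (Fin (exp (z / of_nat q))))"
  shows "deficiency a f = ereal ((real (eps S (Fin 0) a) + real (eps S Infty a)) / real (rat_degree S))"
    and "trunc_deficiency a f = ereal (1 - real (nu S a) / real (rat_degree S))"
proof -
  have lim: "1 - Limsup at_top (\<lambda>r. ereal (F r / nev_T r f)) = ereal (1 - c / real (rat_degree S))"
    if "(\<lambda>r. F r - c / (pi * real q) * r) \<in> O[at_top](\<lambda>r. ln r)" for F c
  proof -
    have "((\<lambda>r. F r / nev_T r f) \<longlongrightarrow> (c / (pi * real q)) / (real (rat_degree S) / (pi * real q))) at_top"
      by (rule tendsto_ratio_linear[OF that]) (use nev_T_asymp[OF assms(1,2)] assms in \<open>simp_all add: f_def\<close>)
    also have "(c / (pi * real q)) / (real (rat_degree S) / (pi * real q)) = c / real (rat_degree S)"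
      using assms by simp
    finally have "Limsup at_top (\<lambda>r. ereal (F r / nev_T r f)) = ereal (c / real (rat_degree S))"
      by (intro lim_imp_Limsup) auto
    thus ?thesis by (simp add: one_ereal_def)
  qed
  have "1 - (real (rat_degree S) - real (eps S (Fin 0) a) - real (eps S Infty a)) / real (rat_degree S) =
      (real (eps S (Fin 0) a) + real (eps S Infty a)) / real (rat_degree S)"
    using n by (simp add: field_simps)
  thus "deficiency a f = ereal ((real (eps S (Fin 0) a) + real (eps S Infty a)) / real (rat_degree S))"
    using lim[OF nev_N_asymp[OF assms(1,2), of a, folded f_def]] unfolding deficiency_def by simp
  show "trunc_deficiency a f = ereal (1 - real (nu S a) / real (rat_degree S))"
    unfolding trunc_deficiency_def by (rule lim[OF nev_Nbar_asymp[OF assms(1,2), of a, folded f_def]])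
qed

theorem theorem8p1:
  fixes q n :: nat
    and S :: "complex poly fract"
    and f :: "complex \<Rightarrow> csphere"
  assumes "q \<ge> 1"
    and "rat_degree S = n" and "n \<ge> 1"
    and "f = (\<lambda>z. rat_map S (Fin (exp (z / of_nat q))))"
  shows
    "(\<forall>a. (\<lambda>r. nev_N r a f
              - (real n - real (eps S (Fin 0) a) - real (eps S Infty a)) / (pi * real q) * r)
            \<in> O[at_top](\<lambda>r. ln r))
   \<and> (\<forall>a. (\<lambda>r. nev_Nbar r a f - real (nu S a) / (pi * real q) * r) \<in> O[at_top](\<lambda>r. ln r))
   \<and> (\<forall>a. deficiency a f
            = ereal ((real (eps S (Fin 0) a) + real (eps S Infty a)) / real n))
   \<and> (\<forall>a. trunc_deficiency a f = ereal (1 - real (nu S a) / real n))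
   \<and> (\<forall>a. deficiency a f > 0 \<longrightarrow> a = rat_map S (Fin 0) \<or> a = rat_map S Infty)
   \<and> finite {a. deficiency a f \<noteq> 0}
   \<and> (\<Sum>a\<in>{a. deficiency a f \<noteq> 0}. deficiency a f)
       = ereal ((real (e_mult S (Fin 0)) + real (e_mult S Infty)) / real n)
   \<and> finite {a. trunc_deficiency a f \<noteq> 0}
   \<and> (\<Sum>a\<in>{a. trunc_deficiency a f \<noteq> 0}. trunc_deficiency a f) = 2
   \<and> (rat_map S (Fin 0) = rat_map S Infty \<longrightarrow>
        deficiency (rat_map S (Fin 0)) f
          = ereal ((real (e_mult S (Fin 0)) + real (e_mult S Infty)) / real n))"
proof -
  have n: "rat_degree S \<ge> 1" "real n \<noteq> 0" using assms by auto
  have def: "deficiency a f = ereal ((real (eps S (Fin 0) a) + real (eps S Infty a)) / real n)" for a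
    using deficiency_rat_exp(1)[OF assms(1) n(1), of a] assms by simp
  have tdef: "trunc_deficiency a f = ereal (1 - real (nu S a) / real n)" for a
    using deficiency_rat_exp(2)[OF assms(1) n(1), of a] assms by simp
  \<comment> \<open>\<open>B\<close> has one element if S(0) = S(Infty). Summing the two kinds of
    \<open>eps\<close> over it separately gives both multiplicities without a case
    distinction.\<close>
  define B where "B = {rat_map S (Fin 0), rat_map S Infty}"
  have finB: "finite B" by (simp add: B_def)
  have eps0: "eps S (Fin 0) a = 0" "eps S Infty a = 0" if "a \<notin> B" for a
    using that by (auto simp: B_def eps_def)
  have def0: "deficiency a f = 0" if "a \<notin> B" for a
    using eps0[OF that] by (simp add: def)
  hence sub: "{a. deficiency a f \<noteq> 0} \<subseteq> B" by blast
  have "(\<Sum>a\<in>{a. deficiency a f \<noteq> 0}. deficiency a f) = (\<Sum>a\<in>B. deficiency a f)"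
    using sub finB by (intro sum.mono_neutral_left) auto
  also have "\<dots> = ereal ((real (\<Sum>a\<in>B. eps S (Fin 0) a) + real (\<Sum>a\<in>B. eps S Infty a)) / real n)"
    by (simp add: def sum_ereal sum.distrib sum_divide_distrib add_divide_distrib)
  also have "(\<Sum>a\<in>B. eps S (Fin 0) a) = e_mult S (Fin 0)"
    unfolding eps_def using finB by (subst sum.delta') (auto simp: B_def)
  also have "(\<Sum>a\<in>B. eps S Infty a) = e_mult S Infty"
    unfolding eps_def using finB by (subst sum.delta') (auto simp: B_def)
  finally have sum_def: "(\<Sum>a\<in>{a. deficiency a f \<noteq> 0}. deficiency a f)
       = ereal ((real (e_mult S (Fin 0)) + real (e_mult S Infty)) / real n)" .
  define A where "A = B \<union> (\<lambda>z. rat_map S (Fin z)) ` {z. poly (wronskian (rat_num S) (rat_den S)) z = 0}"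
  note rh = riemann_hurwitz_nu[OF n(1), folded B_def, folded A_def]
  have tdef0: "trunc_deficiency a f = 0" if "a \<notin> A" for a
    using rh(2)[OF that] assms(2,3) by (simp add: tdef zero_ereal_def)
  hence tsub: "{a. trunc_deficiency a f \<noteq> 0} \<subseteq> A" by blast
  have "(\<Sum>a\<in>{a. trunc_deficiency a f \<noteq> 0}. trunc_deficiency a f) = (\<Sum>a\<in>A. trunc_deficiency a f)"
    using tsub rh(1) by (intro sum.mono_neutral_left) auto
  also have "\<dots> = (\<Sum>a\<in>A. ereal ((real n - real (nu S a)) / real n))"
    using n by (intro sum.cong) (auto simp: tdef diff_divide_distrib)
  also have "\<dots> = ereal ((\<Sum>a\<in>A. real n - real (nu S a)) / real n)"
    by (simp only: sum_ereal sum_divide_distrib)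
  also have "\<dots> = 2" using rh(3) assms(2) n by simp
  finally have sum_tdef: "(\<Sum>a\<in>{a. trunc_deficiency a f \<noteq> 0}. trunc_deficiency a f) = 2" .
  show ?thesis
  proof (intro conjI allI impI)
    fix a
    show "(\<lambda>r. nev_N r a f - (real n - real (eps S (Fin 0) a) - real (eps S Infty a)) / (pi * real q) * r)
            \<in> O[at_top](\<lambda>r. ln r)"
      using nev_N_asymp[OF assms(1) n(1), of a] assms by simp
    show "(\<lambda>r. nev_Nbar r a f - real (nu S a) / (pi * real q) * r) \<in> O[at_top](\<lambda>r. ln r)"
      using nev_Nbar_asymp[OF assms(1) n(1), of a] assms by simp
    show "a = rat_map S (Fin 0) \<or> a = rat_map S Infty" if "deficiency a f > 0"
    proof -
      have "a \<in> B" using def0[of a] that by (cases "a \<in> B") auto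
      thus ?thesis by (simp add: B_def)
    qed
  next
    show "deficiency (rat_map S (Fin 0)) f = ereal ((real (e_mult S (Fin 0)) + real (e_mult S Infty)) / real n)"
      if "rat_map S (Fin 0) = rat_map S Infty"
      using that by (simp add: def eps_def)
  qed (use def tdef sum_def sum_tdef finite_subset[OF sub finB] finite_subset[OF tsub rh(1)] in auto)
qed

end
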